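(* If there is a model of $\mathsf{ZFC}$ (i.e. a set $M$ with a binary relation $\varepsilon$ such that $\langle M,\varepsilon\rangle$ satisfies the first-order axioms of $\mathsf{ZFC}$), then the tree formal system $\texttt{set.mm}$ (described in the context) has a nontrivial model.
   Context: **Tree formal systems.** A tree formal system consists of: a set $TC$ of typecodes; a set $VR$ of variables; a set $SA$ of syntax axioms; a function $\mathrm{Type}:VR\cup SA\to VT$, where $VT=\{\mathrm{Type}(v)\mid v\in VR\}\subseteq TC$; a function $\mathrm{Syn}:TC\to VT$ with $\mathrm{Syn}(c)=c$ for $c\in VT$; for each $a\in SA$ a finite list of distinct variables $v^a_1,\dots,v^a_{n_a}$; and a set $\Gamma$ of statements. Syntax trees are defined inductively: a variable $v$ is a tree of type $\mathrm{Type}(v)$; if $a\in SA$ and $T_1,\dots,T_{n_a}$ are trees with $\mathrm{Type}(T_i)=\mathrm{Type}(v^a_i)$, then $a[T_1,\dots,T_{n_a}]$ is a tree of type $\mathrm{Type}(a)$. An expression is a pair $\langle c,T\rangle$ with $c\in TC$, $T$ a tree and $\mathrm{Syn}(c)=\mathrm{Type}(T)$. A statement is a triple $\langle D,H,A\rangle$ with $A$ an expression, $H$ a finite set of expressions, and $D$ a set of two-element subsets of the set of variables occurring in $H\cup\{A\}$ (the distinct variable conditions). **Models.** Let $U$ assign to each $c\in TC$ a set $U_c$, with $U_c\subseteq U_{\mathrm{Syn}(c)}$. A valuation is a function $\mu$ on $VR$ with $\mu(v)\in U_{\mathrm{Type}(v)}$. A freshness relation is a symmetric relation $\#$ on the disjoint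 union $\bigsqcup_{c\in TC}U_c$ such that for every $c\in VT$ and every finite $W\subseteq\bigsqcup_{c\in TC}U_c$ there is $v\in U_c$ with $v\# w$ for all $w\in W$; here $\#$ is required to treat the copy of $w\in U_c$ in the summand $c$ in the same way as its copy in the summand $\mathrm{Syn}(c)$. Given functions $\pi_a:\prod_i U_{\mathrm{Type}(v^a_i)}\to U_{\mathrm{Type}(a)}$ ($a\in SA$), define $\eta_\mu(v)=\mu(v)$, $\eta_\mu(a[T_1,\dots,T_n])=\pi_a(\eta_\mu(T_1),\dots,\eta_\mu(T_n))$, and $\eta_\mu(\langle c,T\rangle)=\eta_\mu(T)$ if $\eta_\mu(T)\in U_c$, undefined otherwise. A model is a triple $\langle U,\#,\pi\rangle$ of this kind such that for every valuation $\mu$: (1) for each $\langle D,H,A\rangle\in\Gamma$, if $\mu(\alpha)\#\mu(\beta)$ for all $\{\alpha,\beta\}\in D$ and $\eta_\mu(h)$ is defined for all $h\in H$, then $\eta_\mu(A)$ is defined; (2) for all $v\in\bigsqcup U$, $a\in SA$ and $f\in\prod_iU_{\mathrm{Type}(v^a_i)}$, if $v\# f_i$ for all $i$ then $v\#\pi_a(f)$. The model is trivial if $U_c=U_{\mathrm{Syn}(c)}$ for all $c\in TC$, and nontrivial otherwise. **The system $\texttt{set.mm}$ (definitions eliminated).** $TC=\{\mathrm{set},\mathrm{class},\mathrm{wff},\vdash\}$, $VT=\{\mathrm{set},\mathrm{class},\mathrm{wff}\}$, $\mathrm{Syn}(\vdash)=\mathrm{wff}$, with countably infinitely many variables of each type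 in $VT$. Variables: $x,y,z,w,v,u,t$ of type set, $\varphi,\psi,\chi$ of type wff, $A,B$ of type class. Syntax axioms: wff $\lnot\varphi$; wff $(\varphi\to\psi)$; wff $\forall x\,\varphi$; class $\{x\mid\varphi\}$; class $x$ (conversion of a set variable to a class); wff $A=B$; wff $A\in B$. The formulas $x=y$, $x\in y$, $x\in A$, $x=A$ use the conversion of set variables to classes; $\land,\leftrightarrow,\exists$ are the usual abbreviations in terms of $\lnot,\to,\forall$, and $[x/y]\varphi$ abbreviates $((y=x\to\varphi)\land\exists y(y=x\land\varphi))$. The statements in $\Gamma$ are as follows (no hypotheses and no distinct variable conditions unless mentioned): - $\vdash(\varphi\to(\psi\to\varphi))$ - $\vdash((\varphi\to(\psi\to\chi))\to((\varphi\to\psi)\to(\varphi\to\chi)))$ - $\vdash((\lnot\varphi\to\lnot\psi)\to(\psi\to\varphi))$ - from hypotheses $\vdash\varphi$ and $\vdash(\varphi\to\psi)$: $\vdash\psi$ - $\vdash(\forall x(\varphi\to\psi)\to(\forall x\varphi\to\forall x\psi))$ - $\vdash(\lnot\forall x\varphi\to\forall x\lnot\forall x\varphi)$ - $\vdash(\forall x\forall y\varphi\to\forall y\forall x\varphi)$ - from hypothesis $\vdash\varphi$: $\vdash\forall x\varphi$ - $\vdash(x=y\to(x=z\to y=z))$ - $\vdash\lnot\forall x\lnot x=y$ - $\vdash(x=y\to(\forall y\varphi\to\forall x(x=y\to\varphi)))$ - $\vdash(\lnot x=y\to(y=z\to\forall x\,y=z))$ - $\vdash(x=y\to(x\in z\to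 y\in z))$ - $\vdash(x=y\to(z\in x\to z\in y))$ - with $x,\varphi$ distinct: $\vdash(\varphi\to\forall x\,\varphi)$ - (df-clab) $\vdash(x\in\{y\mid\varphi\}\leftrightarrow[x/y]\varphi)$ - (df-cleq) with $x$ distinct from $A$ and from $B$, and $x,y,z$ pairwise distinct, from hypothesis $\vdash(\forall x(x\in y\leftrightarrow x\in z)\to y=z)$: $\vdash(A=B\leftrightarrow\forall x(x\in A\leftrightarrow x\in B))$ - (df-clel) with $x$ distinct from $A$ and from $B$: $\vdash(A\in B\leftrightarrow\exists x(x=A\land x\in B))$ In each of the remaining statements, all set variables occurring are required to be pairwise distinct (no condition is imposed on $\varphi$): - $\vdash(\forall z(z\in x\leftrightarrow z\in y)\to x=y)$ - $\vdash(\forall w\exists y\forall z(\forall y\varphi\to z=y)\to\exists y\forall z(z\in y\leftrightarrow\exists w(w\in x\land\forall y\varphi)))$ - $\vdash\exists y\forall z(\forall w(w\in z\to w\in x)\to z\in y)$ - $\vdash\exists y\forall z(\exists w(z\in w\land w\in x)\to z\in y)$ - $\vdash(\exists y\,y\in x\to\exists y(y\in x\land\forall z(z\in y\to\lnot z\in x)))$ - $\vdash\exists y(x\in y\land\forall z(z\in y\to\exists w(z\in w\land w\in y)))$ - $\vdash\exists y\forall z\forall w((z\in w\land w\in x)\to\exists v\forall u(\exists t((u\in w\land w\in t)\land(u\in t\land t\in y))\leftrightarrow u=v))$ *)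

theory Defs
  imports Main
begin

section \<open>Tree formal systems\<close>

datatype (vars_tree: 'v, axs_tree: 'a) syn_tree =
    Var 'v
  | App 'a "('v, 'a) syn_tree list"

type_synonym ('c, 'v, 'a) expression = "'c \<times> ('v, 'a) syn_tree"

text \<open>The statement \<open>\<langle>D, H, A\<rangle>\<close>.\<close>

type_synonym ('c, 'v, 'a) stmt =
  "'v set set \<times> ('c, 'v, 'a) expression set \<times> ('c, 'v, 'a) expression"

text \<open>The map \<open>Type\<close> on the union of \<open>VR\<close> and \<open>SA\<close> is split into \<open>type_var\<close> and \<open>type_ax\<close>.\<close>

record ('c, 'v, 'a) tfs =
  TC :: "'c set"
  VR :: "'v set"
  SA :: "'a set"
  type_var :: "'v \<Rightarrow> 'c"
  type_ax :: "'a \<Rightarrow> 'c"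
  Syn :: "'c \<Rightarrow> 'c"
  args :: "'a \<Rightarrow> 'v list"
  stmts :: "('c, 'v, 'a) stmt set"

definition VT :: "('c, 'v, 'a) tfs \<Rightarrow> 'c set" where
  "VT S = type_var S ` VR S"

inductive has_type :: "('c, 'v, 'a) tfs \<Rightarrow> ('v, 'a) syn_tree \<Rightarrow> 'c \<Rightarrow> bool"
  for S where
  Var: "v \<in> VR S \<Longrightarrow> has_type S (Var v) (type_var S v)"
| App: "a \<in> SA S \<Longrightarrow> list_all2 (\<lambda>T v. has_type S T (type_var S v)) Ts (args S a)
        \<Longrightarrow> has_type S (App a Ts) (type_ax S a)"

definition is_expr :: "('c, 'v, 'a) tfs \<Rightarrow> ('c, 'v, 'a) expression \<Rightarrow> bool" where
  "is_expr S = (\<lambda>(c, T). c \<in> TC S \<and> has_type S T (Syn S c))"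

definition vars_exprs :: "('c, 'v, 'a) expression set \<Rightarrow> 'v set" where
  "vars_exprs X = (\<Union>(c, T) \<in> X. vars_tree T)"

definition pairs :: "'v set \<Rightarrow> 'v set set" where
  "pairs V = {{\<alpha>, \<beta>} | \<alpha> \<beta>. \<alpha> \<in> V \<and> \<beta> \<in> V \<and> \<alpha> \<noteq> \<beta>}"

definition is_stmt :: "('c, 'v, 'a) tfs \<Rightarrow> ('c, 'v, 'a) stmt \<Rightarrow> bool" where
  "is_stmt S = (\<lambda>(D, H, A). is_expr S A \<and> finite H \<and> (\<forall>h\<in>H. is_expr S h)
     \<and> D \<subseteq> pairs (vars_exprs (H \<union> {A})))"

definition tree_formal_system :: "('c, 'v, 'a) tfs \<Rightarrow> bool" where
  "tree_formal_system S \<longleftrightarrow>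
     VT S \<subseteq> TC S
   \<and> (\<forall>a\<in>SA S. type_ax S a \<in> VT S)
   \<and> (\<forall>c\<in>TC S. Syn S c \<in> VT S)
   \<and> (\<forall>c\<in>VT S. Syn S c = c)
   \<and> (\<forall>a\<in>SA S. distinct (args S a) \<and> set (args S a) \<subseteq> VR S)
   \<and> (\<forall>s\<in>stmts S. is_stmt S s)"


section \<open>Models of tree formal systems\<close>

text \<open>
  All the sets \<open>U c\<close> live in one type \<open>'u\<close> and may overlap; the disjoint union consists
  of tagged elements.
\<close>

definition dunion :: "('c, 'v, 'a) tfs \<Rightarrow> ('c \<Rightarrow> 'u set) \<Rightarrow> ('c \<times> 'u) set" where
  "dunion S U = (SIGMA c : TC S. U c)"

definition valuation :: "('c, 'v, 'a) tfs \<Rightarrow> ('c \<Rightarrow> 'u set) \<Rightarrow> ('v \<Rightarrow> 'u) \<Rightarrow> bool" where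
  "valuation S U \<mu> \<longleftrightarrow> (\<forall>v\<in>VR S. \<mu> v \<in> U (type_var S v))"

definition freshness ::
    "('c, 'v, 'a) tfs \<Rightarrow> ('c \<Rightarrow> 'u set) \<Rightarrow> (('c \<times> 'u) \<times> ('c \<times> 'u)) set \<Rightarrow> bool" where
  "freshness S U F \<longleftrightarrow>
     F \<subseteq> dunion S U \<times> dunion S U
   \<and> sym F
   \<and> (\<forall>c\<in>VT S. \<forall>W. finite W \<and> W \<subseteq> dunion S U \<longrightarrow> (\<exists>v\<in>U c. \<forall>w\<in>W. ((c, v), w) \<in> F))
   \<and> (\<forall>c\<in>TC S. \<forall>w\<in>U c. \<forall>z\<in>dunion S U. ((c, w), z) \<in> F \<longleftrightarrow> ((Syn S c, w), z) \<in> F)"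

text \<open>Elements of \<open>\<Prod>\<^sub>i U (Type v\<^sup>a\<^sub>i)\<close> are lists of the same length as \<open>args S a\<close>.\<close>

definition arg_tuples :: "('c, 'v, 'a) tfs \<Rightarrow> ('c \<Rightarrow> 'u set) \<Rightarrow> 'a \<Rightarrow> 'u list set" where
  "arg_tuples S U a = {f. list_all2 (\<lambda>u v. u \<in> U (type_var S v)) f (args S a)}"

primrec eval_tree :: "('a \<Rightarrow> 'u list \<Rightarrow> 'u) \<Rightarrow> ('v \<Rightarrow> 'u) \<Rightarrow> ('v, 'a) syn_tree \<Rightarrow> 'u" where
  "eval_tree \<pi> \<mu> (Var v) = \<mu> v"
| "eval_tree \<pi> \<mu> (App a Ts) = \<pi> a (map (eval_tree \<pi> \<mu>) Ts)"

definition eval_expr ::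
    "('c \<Rightarrow> 'u set) \<Rightarrow> ('a \<Rightarrow> 'u list \<Rightarrow> 'u) \<Rightarrow> ('v \<Rightarrow> 'u) \<Rightarrow> ('c, 'v, 'a) expression \<Rightarrow> 'u option" where
  "eval_expr U \<pi> \<mu> = (\<lambda>(c, T). if eval_tree \<pi> \<mu> T \<in> U c then Some (eval_tree \<pi> \<mu> T) else None)"

definition tfs_model ::
    "('c, 'v, 'a) tfs \<Rightarrow> ('c \<Rightarrow> 'u set) \<Rightarrow> (('c \<times> 'u) \<times> ('c \<times> 'u)) set
      \<Rightarrow> ('a \<Rightarrow> 'u list \<Rightarrow> 'u) \<Rightarrow> bool" where
  "tfs_model S U F \<pi> \<longleftrightarrow>
     (\<forall>c\<in>TC S. U c \<subseteq> U (Syn S c))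
   \<and> freshness S U F
   \<and> (\<forall>a\<in>SA S. \<forall>f\<in>arg_tuples S U a. \<pi> a f \<in> U (type_ax S a))
   \<and> (\<forall>\<mu>. valuation S U \<mu> \<longrightarrow>
        (\<forall>(D, H, A)\<in>stmts S.
           (\<forall>\<alpha> \<beta>. {\<alpha>, \<beta>} \<in> D \<longrightarrow> ((type_var S \<alpha>, \<mu> \<alpha>), (type_var S \<beta>, \<mu> \<beta>)) \<in> F)
           \<and> (\<forall>h\<in>H. eval_expr U \<pi> \<mu> h \<noteq> None)
           \<longrightarrow> eval_expr U \<pi> \<mu> A \<noteq> None))
   \<and> (\<forall>v\<in>dunion S U. \<forall>a\<in>SA S. \<forall>f\<in>arg_tuples S U a.
        (\<forall>i<length (args S a). (v, (type_var S (args S a ! i), f ! i)) \<in> F)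
        \<longrightarrow> (v, (type_ax S a, \<pi> a f)) \<in> F)"

definition trivial_universe :: "('c, 'v, 'a) tfs \<Rightarrow> ('c \<Rightarrow> 'u set) \<Rightarrow> bool" where
  "trivial_universe S U \<longleftrightarrow> (\<forall>c\<in>TC S. U c = U (Syn S c))"


section \<open>The system set.mm\<close>

datatype typecode = TSet | TClass | TWff | TProv

datatype mvar = SetV nat | ClassV nat | WffV nat

datatype synax = SNot | SImp | SAll | SAbs | SCv | SEq | SMem

type_synonym mtree = "(mvar, synax) syn_tree"

fun mvar_type :: "mvar \<Rightarrow> typecode" where
  "mvar_type (SetV n) = TSet"
| "mvar_type (ClassV n) = TClass"
| "mvar_type (WffV n) = TWff"

fun synax_type :: "synax \<Rightarrow> typecode" where
  "synax_type SAbs = TClass"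
| "synax_type SCv = TClass"
| "synax_type _ = TWff"

fun mm_syn :: "typecode \<Rightarrow> typecode" where
  "mm_syn TProv = TWff"
| "mm_syn c = c"

abbreviation "vx \<equiv> SetV 0"
abbreviation "vy \<equiv> SetV 1"
abbreviation "vz \<equiv> SetV 2"
abbreviation "vw \<equiv> SetV 3"
abbreviation "vv \<equiv> SetV 4"
abbreviation "vu \<equiv> SetV 5"
abbreviation "vt \<equiv> SetV 6"
abbreviation "vA \<equiv> ClassV 0"
abbreviation "vB \<equiv> ClassV 1"
abbreviation "vph \<equiv> WffV 0"
abbreviation "vps \<equiv> WffV 1"
abbreviation "vch \<equiv> WffV 2"

abbreviation CA :: mtree where "CA \<equiv> Var vA"
abbreviation CB :: mtree where "CB \<equiv> Var vB"
abbreviation PH :: mtree where "PH \<equiv> Var vph"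
abbreviation PS :: mtree where "PS \<equiv> Var vps"
abbreviation CH :: mtree where "CH \<equiv> Var vch"

fun synax_args :: "synax \<Rightarrow> mvar list" where
  "synax_args SNot = [vph]"
| "synax_args SImp = [vph, vps]"
| "synax_args SAll = [vx, vph]"
| "synax_args SAbs = [vx, vph]"
| "synax_args SCv = [vx]"
| "synax_args SEq = [vA, vB]"
| "synax_args SMem = [vA, vB]"

text \<open>\<open>\<langle>x\<rangle>\<close> is the conversion of the set variable \<open>x\<close> to a class.\<close>

abbreviation mCv :: "mvar \<Rightarrow> mtree" (\<open>\<langle>_\<rangle>\<close>) where
  "\<langle>x\<rangle> \<equiv> App SCv [Var x]"
abbreviation mNot :: "mtree \<Rightarrow> mtree" (\<open>\<^bold>\<not> _\<close> [60] 60) where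
  "\<^bold>\<not> p \<equiv> App SNot [p]"
abbreviation mImp :: "mtree \<Rightarrow> mtree \<Rightarrow> mtree" (infixr \<open>\<^bold>\<rightarrow>\<close> 54) where
  "p \<^bold>\<rightarrow> q \<equiv> App SImp [p, q]"
abbreviation mAll :: "mvar \<Rightarrow> mtree \<Rightarrow> mtree" (\<open>(3\<^bold>\<forall>_./ _)\<close> [0, 53] 53) where
  "\<^bold>\<forall>x. p \<equiv> App SAll [Var x, p]"
abbreviation mAbs :: "mvar \<Rightarrow> mtree \<Rightarrow> mtree" (\<open>\<^bold>{_ \<^bold>| _\<^bold>}\<close>) where
  "\<^bold>{x \<^bold>| p\<^bold>} \<equiv> App SAbs [Var x, p]"
abbreviation mEq :: "mtree \<Rightarrow> mtree \<Rightarrow> mtree" (infix \<open>\<^bold>=\<close> 62) where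
  "A \<^bold>= B \<equiv> App SEq [A, B]"
abbreviation mMem :: "mtree \<Rightarrow> mtree \<Rightarrow> mtree" (infix \<open>\<^bold>\<in>\<close> 62) where
  "A \<^bold>\<in> B \<equiv> App SMem [A, B]"
abbreviation mAnd :: "mtree \<Rightarrow> mtree \<Rightarrow> mtree" (infixr \<open>\<^bold>\<and>\<close> 58) where
  "p \<^bold>\<and> q \<equiv> \<^bold>\<not> (p \<^bold>\<rightarrow> \<^bold>\<not> q)"
abbreviation mIff :: "mtree \<Rightarrow> mtree \<Rightarrow> mtree" (infix \<open>\<^bold>\<leftrightarrow>\<close> 55) where
  "p \<^bold>\<leftrightarrow> q \<equiv> (p \<^bold>\<rightarrow> q) \<^bold>\<and> (q \<^bold>\<rightarrow> p)"
abbreviation mEx :: "mvar \<Rightarrow> mtree \<Rightarrow> mtree" (\<open>(3\<^bold>\<exists>_./ _)\<close> [0, 53] 53) where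
  "\<^bold>\<exists>x. p \<equiv> \<^bold>\<not> (\<^bold>\<forall>x. \<^bold>\<not> p)"
abbreviation mSub :: "mvar \<Rightarrow> mvar \<Rightarrow> mtree \<Rightarrow> mtree" (\<open>\<^bold>[_\<^bold>'/_\<^bold>] _\<close> [0, 0, 60] 60) where
  "\<^bold>[x\<^bold>/y\<^bold>] p \<equiv> (\<langle>y\<rangle> \<^bold>= \<langle>x\<rangle> \<^bold>\<rightarrow> p) \<^bold>\<and> (\<^bold>\<exists>y. \<langle>y\<rangle> \<^bold>= \<langle>x\<rangle> \<^bold>\<and> p)"
abbreviation mProv :: "mtree \<Rightarrow> (typecode, mvar, synax) expression" (\<open>\<^bold>\<turnstile> _\<close> [50] 50) where
  "\<^bold>\<turnstile> p \<equiv> (TProv, p)"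

definition logic_stmts :: "(typecode, mvar, synax) stmt set" where
  "logic_stmts = {
    ({}, {}, \<^bold>\<turnstile> PH \<^bold>\<rightarrow> (PS \<^bold>\<rightarrow> PH)),
    ({}, {}, \<^bold>\<turnstile> (PH \<^bold>\<rightarrow> (PS \<^bold>\<rightarrow> CH)) \<^bold>\<rightarrow> ((PH \<^bold>\<rightarrow> PS) \<^bold>\<rightarrow> (PH \<^bold>\<rightarrow> CH))),
    ({}, {}, \<^bold>\<turnstile> (\<^bold>\<not> PH \<^bold>\<rightarrow> \<^bold>\<not> PS) \<^bold>\<rightarrow> (PS \<^bold>\<rightarrow> PH)),
    ({}, {\<^bold>\<turnstile> PH, \<^bold>\<turnstile> PH \<^bold>\<rightarrow> PS}, \<^bold>\<turnstile> PS),
    ({}, {}, \<^bold>\<turnstile> (\<^bold>\<forall>vx. PH \<^bold>\<rightarrow> PS) \<^bold>\<rightarrow> ((\<^bold>\<forall>vx. PH) \<^bold>\<rightarrow> (\<^bold>\<forall>vx. PS))),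
    ({}, {}, \<^bold>\<turnstile> \<^bold>\<not> (\<^bold>\<forall>vx. PH) \<^bold>\<rightarrow> (\<^bold>\<forall>vx. \<^bold>\<not> (\<^bold>\<forall>vx. PH))),
    ({}, {}, \<^bold>\<turnstile> (\<^bold>\<forall>vx. \<^bold>\<forall>vy. PH) \<^bold>\<rightarrow> (\<^bold>\<forall>vy. \<^bold>\<forall>vx. PH)),
    ({}, {\<^bold>\<turnstile> PH}, \<^bold>\<turnstile> (\<^bold>\<forall>vx. PH)),
    ({}, {}, \<^bold>\<turnstile> \<langle>vx\<rangle> \<^bold>= \<langle>vy\<rangle> \<^bold>\<rightarrow> (\<langle>vx\<rangle> \<^bold>= \<langle>vz\<rangle> \<^bold>\<rightarrow> \<langle>vy\<rangle> \<^bold>= \<langle>vz\<rangle>)),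
    ({}, {}, \<^bold>\<turnstile> \<^bold>\<not> (\<^bold>\<forall>vx. \<^bold>\<not> \<langle>vx\<rangle> \<^bold>= \<langle>vy\<rangle>)),
    ({}, {}, \<^bold>\<turnstile> \<langle>vx\<rangle> \<^bold>= \<langle>vy\<rangle> \<^bold>\<rightarrow> ((\<^bold>\<forall>vy. PH) \<^bold>\<rightarrow> (\<^bold>\<forall>vx. \<langle>vx\<rangle> \<^bold>= \<langle>vy\<rangle> \<^bold>\<rightarrow> PH))),
    ({}, {}, \<^bold>\<turnstile> \<^bold>\<not> \<langle>vx\<rangle> \<^bold>= \<langle>vy\<rangle> \<^bold>\<rightarrow> (\<langle>vy\<rangle> \<^bold>= \<langle>vz\<rangle> \<^bold>\<rightarrow> (\<^bold>\<forall>vx. \<langle>vy\<rangle> \<^bold>= \<langle>vz\<rangle>))),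
    ({}, {}, \<^bold>\<turnstile> \<langle>vx\<rangle> \<^bold>= \<langle>vy\<rangle> \<^bold>\<rightarrow> (\<langle>vx\<rangle> \<^bold>\<in> \<langle>vz\<rangle> \<^bold>\<rightarrow> \<langle>vy\<rangle> \<^bold>\<in> \<langle>vz\<rangle>)),
    ({}, {}, \<^bold>\<turnstile> \<langle>vx\<rangle> \<^bold>= \<langle>vy\<rangle> \<^bold>\<rightarrow> (\<langle>vz\<rangle> \<^bold>\<in> \<langle>vx\<rangle> \<^bold>\<rightarrow> \<langle>vz\<rangle> \<^bold>\<in> \<langle>vy\<rangle>)),
    ({{vx, vph}}, {}, \<^bold>\<turnstile> PH \<^bold>\<rightarrow> (\<^bold>\<forall>vx. PH))}"

definition class_stmts :: "(typecode, mvar, synax) stmt set" where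
  "class_stmts = {
    ({}, {}, \<^bold>\<turnstile> \<langle>vx\<rangle> \<^bold>\<in> \<^bold>{vy \<^bold>| PH\<^bold>} \<^bold>\<leftrightarrow> \<^bold>[vx\<^bold>/vy\<^bold>] PH),
    ({{vx, vA}, {vx, vB}, {vx, vy}, {vx, vz}, {vy, vz}},
     {\<^bold>\<turnstile> (\<^bold>\<forall>vx. \<langle>vx\<rangle> \<^bold>\<in> \<langle>vy\<rangle> \<^bold>\<leftrightarrow> \<langle>vx\<rangle> \<^bold>\<in> \<langle>vz\<rangle>) \<^bold>\<rightarrow> \<langle>vy\<rangle> \<^bold>= \<langle>vz\<rangle>},
     \<^bold>\<turnstile> CA \<^bold>= CB \<^bold>\<leftrightarrow> (\<^bold>\<forall>vx. \<langle>vx\<rangle> \<^bold>\<in> CA \<^bold>\<leftrightarrow> \<langle>vx\<rangle> \<^bold>\<in> CB)),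
    ({{vx, vA}, {vx, vB}}, {},
     \<^bold>\<turnstile> CA \<^bold>\<in> CB \<^bold>\<leftrightarrow> (\<^bold>\<exists>vx. \<langle>vx\<rangle> \<^bold>= CA \<^bold>\<and> \<langle>vx\<rangle> \<^bold>\<in> CB))}"

definition zfc_stmts :: "(typecode, mvar, synax) stmt set" where
  "zfc_stmts = {
    (pairs {vx, vy, vz}, {},
     \<^bold>\<turnstile> (\<^bold>\<forall>vz. \<langle>vz\<rangle> \<^bold>\<in> \<langle>vx\<rangle> \<^bold>\<leftrightarrow> \<langle>vz\<rangle> \<^bold>\<in> \<langle>vy\<rangle>) \<^bold>\<rightarrow> \<langle>vx\<rangle> \<^bold>= \<langle>vy\<rangle>),
    (pairs {vx, vy, vz, vw}, {},
     \<^bold>\<turnstile> (\<^bold>\<forall>vw. \<^bold>\<exists>vy. \<^bold>\<forall>vz. (\<^bold>\<forall>vy. PH) \<^bold>\<rightarrow> \<langle>vz\<rangle> \<^bold>= \<langle>vy\<rangle>)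
       \<^bold>\<rightarrow> (\<^bold>\<exists>vy. \<^bold>\<forall>vz. \<langle>vz\<rangle> \<^bold>\<in> \<langle>vy\<rangle> \<^bold>\<leftrightarrow> (\<^bold>\<exists>vw. \<langle>vw\<rangle> \<^bold>\<in> \<langle>vx\<rangle> \<^bold>\<and> (\<^bold>\<forall>vy. PH)))),
    (pairs {vx, vy, vz, vw}, {},
     \<^bold>\<turnstile> (\<^bold>\<exists>vy. \<^bold>\<forall>vz. (\<^bold>\<forall>vw. \<langle>vw\<rangle> \<^bold>\<in> \<langle>vz\<rangle> \<^bold>\<rightarrow> \<langle>vw\<rangle> \<^bold>\<in> \<langle>vx\<rangle>) \<^bold>\<rightarrow> \<langle>vz\<rangle> \<^bold>\<in> \<langle>vy\<rangle>)),
    (pairs {vx, vy, vz, vw}, {},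
     \<^bold>\<turnstile> (\<^bold>\<exists>vy. \<^bold>\<forall>vz. (\<^bold>\<exists>vw. \<langle>vz\<rangle> \<^bold>\<in> \<langle>vw\<rangle> \<^bold>\<and> \<langle>vw\<rangle> \<^bold>\<in> \<langle>vx\<rangle>) \<^bold>\<rightarrow> \<langle>vz\<rangle> \<^bold>\<in> \<langle>vy\<rangle>)),
    (pairs {vx, vy, vz}, {},
     \<^bold>\<turnstile> (\<^bold>\<exists>vy. \<langle>vy\<rangle> \<^bold>\<in> \<langle>vx\<rangle>)
       \<^bold>\<rightarrow> (\<^bold>\<exists>vy. \<langle>vy\<rangle> \<^bold>\<in> \<langle>vx\<rangle> \<^bold>\<and> (\<^bold>\<forall>vz. \<langle>vz\<rangle> \<^bold>\<in> \<langle>vy\<rangle> \<^bold>\<rightarrow> \<^bold>\<not> \<langle>vz\<rangle> \<^bold>\<in> \<langle>vx\<rangle>))),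
    (pairs {vx, vy, vz, vw}, {},
     \<^bold>\<turnstile> (\<^bold>\<exists>vy. \<langle>vx\<rangle> \<^bold>\<in> \<langle>vy\<rangle>
         \<^bold>\<and> (\<^bold>\<forall>vz. \<langle>vz\<rangle> \<^bold>\<in> \<langle>vy\<rangle> \<^bold>\<rightarrow> (\<^bold>\<exists>vw. \<langle>vz\<rangle> \<^bold>\<in> \<langle>vw\<rangle> \<^bold>\<and> \<langle>vw\<rangle> \<^bold>\<in> \<langle>vy\<rangle>)))),
    (pairs {vx, vy, vz, vw, vv, vu, vt}, {},
     \<^bold>\<turnstile> (\<^bold>\<exists>vy. \<^bold>\<forall>vz. \<^bold>\<forall>vw. \<langle>vz\<rangle> \<^bold>\<in> \<langle>vw\<rangle> \<^bold>\<and> \<langle>vw\<rangle> \<^bold>\<in> \<langle>vx\<rangle>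
         \<^bold>\<rightarrow> (\<^bold>\<exists>vv. \<^bold>\<forall>vu. (\<^bold>\<exists>vt. (\<langle>vu\<rangle> \<^bold>\<in> \<langle>vw\<rangle> \<^bold>\<and> \<langle>vw\<rangle> \<^bold>\<in> \<langle>vt\<rangle>) \<^bold>\<and> (\<langle>vu\<rangle> \<^bold>\<in> \<langle>vt\<rangle> \<^bold>\<and> \<langle>vt\<rangle> \<^bold>\<in> \<langle>vy\<rangle>))
                \<^bold>\<leftrightarrow> \<langle>vu\<rangle> \<^bold>= \<langle>vv\<rangle>)))}"

definition set_mm :: "(typecode, mvar, synax) tfs" where
  "set_mm = \<lparr> TC = UNIV, VR = UNIV, SA = UNIV, type_var = mvar_type, type_ax = synax_type,
     Syn = mm_syn, args = synax_args, stmts = logic_stmts \<union> class_stmts \<union> zfc_stmts \<rparr>"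

lemma has_type_Var_iff [simp]:
  "has_type S (Var v) c \<longleftrightarrow> v \<in> VR S \<and> c = type_var S v"
  by (auto intro: has_type.intros elim: has_type.cases)

lemma has_type_App_iff [simp]:
  "has_type S (App a Ts) c \<longleftrightarrow> a \<in> SA S \<and> c = type_ax S a
     \<and> list_all2 (\<lambda>T v. has_type S T (type_var S v)) Ts (args S a)"
  by (auto intro: has_type.intros elim: has_type.cases)

lemma VT_set_mm: "VT set_mm = {TSet, TClass, TWff}"
proof -
  have "mvar_type v \<in> {TSet, TClass, TWff}" for v
    by (cases v) auto
  moreover have "{mvar_type (SetV 0), mvar_type (ClassV 0), mvar_type (WffV 0)} \<subseteq> range mvar_type"
    by blast
  ultimately have "range mvar_type = {TSet, TClass, TWff}"
    by auto
  then show ?thesis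
    by (simp add: VT_def set_mm_def)
qed

lemma pairs_mono: "V \<subseteq> W \<Longrightarrow> pairs V \<subseteq> pairs W"
  unfolding pairs_def by blast

lemma doubleton_in_pairs: "{\<alpha>, \<beta>} \<in> pairs V \<longleftrightarrow> \<alpha> \<in> V \<and> \<beta> \<in> V \<and> \<alpha> \<noteq> \<beta>"
  unfolding pairs_def by (auto simp: doubleton_eq_iff)

lemma set_mm_stmts:
  assumes "s \<in> stmts set_mm" shows "is_stmt set_mm s"
proof -
  have "\<forall>s\<in>logic_stmts. is_stmt set_mm s"
    unfolding logic_stmts_def
    by (simp add: is_stmt_def is_expr_def set_mm_def vars_exprs_def doubleton_in_pairs)
  moreover have "\<forall>s\<in>class_stmts. is_stmt set_mm s"
    unfolding class_stmts_def
    by (simp add: is_stmt_def is_expr_def set_mm_def vars_exprs_def doubleton_in_pairs)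
  moreover have "\<forall>s\<in>zfc_stmts. is_stmt set_mm s"
    unfolding zfc_stmts_def
    by (simp add: is_stmt_def is_expr_def set_mm_def vars_exprs_def pairs_mono)
  ultimately show ?thesis
    using assms by (auto simp: set_mm_def)
qed

lemma tree_formal_system_set_mm: "tree_formal_system set_mm"
proof -
  have "synax_type a \<in> {TSet, TClass, TWff}" "distinct (synax_args a)" for a
    by (cases a; simp)+
  moreover have "mm_syn c \<in> {TSet, TClass, TWff}" for c
    by (cases c) simp_all
  ultimately show ?thesis
    unfolding tree_formal_system_def VT_set_mm using set_mm_stmts by (auto simp: set_mm_def)
qed


section \<open>First-order models of ZFC\<close>

text \<open>Formulas of the language of set theory, with variables named by natural numbers.\<close>

datatype fm =
    FMem nat nat (infix \<open>\<in>\<^sub>f\<close> 62)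
  | FEq nat nat (infix \<open>=\<^sub>f\<close> 62)
  | FNot fm (\<open>\<not>\<^sub>f _\<close> [60] 60)
  | FImp fm fm (infixr \<open>\<rightarrow>\<^sub>f\<close> 54)
  | FAll nat fm (\<open>(3\<forall>\<^sub>f _./ _)\<close> [0, 53] 53)

abbreviation FAnd :: "fm \<Rightarrow> fm \<Rightarrow> fm" (infixr \<open>\<and>\<^sub>f\<close> 58) where
  "p \<and>\<^sub>f q \<equiv> \<not>\<^sub>f (p \<rightarrow>\<^sub>f \<not>\<^sub>f q)"
abbreviation FOr :: "fm \<Rightarrow> fm \<Rightarrow> fm" (infixr \<open>\<or>\<^sub>f\<close> 56) where
  "p \<or>\<^sub>f q \<equiv> \<not>\<^sub>f p \<rightarrow>\<^sub>f q"
abbreviation FIff :: "fm \<Rightarrow> fm \<Rightarrow> fm" (infix \<open>\<leftrightarrow>\<^sub>f\<close> 55) where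
  "p \<leftrightarrow>\<^sub>f q \<equiv> (p \<rightarrow>\<^sub>f q) \<and>\<^sub>f (q \<rightarrow>\<^sub>f p)"
abbreviation FEx :: "nat \<Rightarrow> fm \<Rightarrow> fm" (\<open>(3\<exists>\<^sub>f _./ _)\<close> [0, 53] 53) where
  "\<exists>\<^sub>f x. p \<equiv> \<not>\<^sub>f (\<forall>\<^sub>f x. \<not>\<^sub>f p)"

primrec free_vars :: "fm \<Rightarrow> nat set" where
  "free_vars (x \<in>\<^sub>f y) = {x, y}"
| "free_vars (x =\<^sub>f y) = {x, y}"
| "free_vars (\<not>\<^sub>f p) = free_vars p"
| "free_vars (p \<rightarrow>\<^sub>f q) = free_vars p \<union> free_vars q"
| "free_vars (\<forall>\<^sub>f x. p) = free_vars p - {x}"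

primrec sat :: "'m set \<Rightarrow> ('m \<times> 'm) set \<Rightarrow> (nat \<Rightarrow> 'm) \<Rightarrow> fm \<Rightarrow> bool" where
  "sat M E s (x \<in>\<^sub>f y) \<longleftrightarrow> (s x, s y) \<in> E"
| "sat M E s (x =\<^sub>f y) \<longleftrightarrow> s x = s y"
| "sat M E s (\<not>\<^sub>f p) \<longleftrightarrow> \<not> sat M E s p"
| "sat M E s (p \<rightarrow>\<^sub>f q) \<longleftrightarrow> (sat M E s p \<longrightarrow> sat M E s q)"
| "sat M E s (\<forall>\<^sub>f x. p) \<longleftrightarrow> (\<forall>m\<in>M. sat M E (s(x := m)) p)"

definition ax_extensionality :: fm where
  "ax_extensionality = (\<forall>\<^sub>f 0. \<forall>\<^sub>f 1. (\<forall>\<^sub>f 2. 2 \<in>\<^sub>f 0 \<leftrightarrow>\<^sub>f 2 \<in>\<^sub>f 1) \<rightarrow>\<^sub>f 0 =\<^sub>f 1)"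

definition ax_foundation :: fm where
  "ax_foundation =
    (\<forall>\<^sub>f 0. (\<exists>\<^sub>f 1. 1 \<in>\<^sub>f 0) \<rightarrow>\<^sub>f (\<exists>\<^sub>f 1. 1 \<in>\<^sub>f 0 \<and>\<^sub>f \<not>\<^sub>f (\<exists>\<^sub>f 2. 2 \<in>\<^sub>f 0 \<and>\<^sub>f 2 \<in>\<^sub>f 1)))"

definition ax_pairing :: fm where
  "ax_pairing = (\<forall>\<^sub>f 0. \<forall>\<^sub>f 1. \<exists>\<^sub>f 2. \<forall>\<^sub>f 3. 3 \<in>\<^sub>f 2 \<leftrightarrow>\<^sub>f (3 =\<^sub>f 0 \<or>\<^sub>f 3 =\<^sub>f 1))"

definition ax_union :: fm where
  "ax_union = (\<forall>\<^sub>f 0. \<exists>\<^sub>f 1. \<forall>\<^sub>f 2. 2 \<in>\<^sub>f 1 \<leftrightarrow>\<^sub>f (\<exists>\<^sub>f 3. 2 \<in>\<^sub>f 3 \<and>\<^sub>f 3 \<in>\<^sub>f 0))"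

definition ax_power :: fm where
  "ax_power = (\<forall>\<^sub>f 0. \<exists>\<^sub>f 1. \<forall>\<^sub>f 2. 2 \<in>\<^sub>f 1 \<leftrightarrow>\<^sub>f (\<forall>\<^sub>f 3. 3 \<in>\<^sub>f 2 \<rightarrow>\<^sub>f 3 \<in>\<^sub>f 0))"

text \<open>There is a set containing \<open>\<emptyset>\<close> and closed under \<open>y \<mapsto> y \<union> {y}\<close>.\<close>

definition ax_infinity :: fm where
  "ax_infinity =
    (\<exists>\<^sub>f 0. (\<exists>\<^sub>f 1. 1 \<in>\<^sub>f 0 \<and>\<^sub>f (\<forall>\<^sub>f 2. \<not>\<^sub>f 2 \<in>\<^sub>f 1))
       \<and>\<^sub>f (\<forall>\<^sub>f 1. 1 \<in>\<^sub>f 0 \<rightarrow>\<^sub>f (\<exists>\<^sub>f 2. 2 \<in>\<^sub>f 0 \<and>\<^sub>f (\<forall>\<^sub>f 3. 3 \<in>\<^sub>f 2 \<leftrightarrow>\<^sub>f (3 \<in>\<^sub>f 1 \<or>\<^sub>f 3 =\<^sub>f 1)))))"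

text \<open>Every family of pairwise disjoint nonempty sets has a transversal.\<close>

definition ax_choice :: fm where
  "ax_choice =
    (\<forall>\<^sub>f 0. (\<forall>\<^sub>f 1. 1 \<in>\<^sub>f 0 \<rightarrow>\<^sub>f (\<exists>\<^sub>f 2. 2 \<in>\<^sub>f 1))
       \<and>\<^sub>f (\<forall>\<^sub>f 1. \<forall>\<^sub>f 2. 1 \<in>\<^sub>f 0 \<and>\<^sub>f 2 \<in>\<^sub>f 0 \<and>\<^sub>f \<not>\<^sub>f 1 =\<^sub>f 2 \<rightarrow>\<^sub>f \<not>\<^sub>f (\<exists>\<^sub>f 3. 3 \<in>\<^sub>f 1 \<and>\<^sub>f 3 \<in>\<^sub>f 2))
       \<rightarrow>\<^sub>f (\<exists>\<^sub>f 4. \<forall>\<^sub>f 1. 1 \<in>\<^sub>f 0 \<rightarrow>\<^sub>f (\<exists>\<^sub>f 2. \<forall>\<^sub>f 3. (3 \<in>\<^sub>f 1 \<and>\<^sub>f 3 \<in>\<^sub>f 4) \<leftrightarrow>\<^sub>f 3 =\<^sub>f 2)))"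

text \<open>
  In the two schemas the free variables of \<open>p\<close> that are not displayed are parameters; they are
  universally quantified because validity in a structure refers to all assignments.
\<close>

definition ax_separation :: "fm set" where
  "ax_separation =
    {(\<forall>\<^sub>f a. \<exists>\<^sub>f b. \<forall>\<^sub>f x. x \<in>\<^sub>f b \<leftrightarrow>\<^sub>f (x \<in>\<^sub>f a \<and>\<^sub>f p)) | a b x p.
       distinct [a, b, x] \<and> b \<notin> free_vars p}"

definition ax_replacement :: "fm set" where
  "ax_replacement =
    {(\<forall>\<^sub>f x. \<exists>\<^sub>f u. \<forall>\<^sub>f y. p \<rightarrow>\<^sub>f y =\<^sub>f u)
       \<rightarrow>\<^sub>f (\<forall>\<^sub>f a. \<exists>\<^sub>f b. \<forall>\<^sub>f y. y \<in>\<^sub>f b \<leftrightarrow>\<^sub>f (\<exists>\<^sub>f x. x \<in>\<^sub>f a \<and>\<^sub>f p)) | a b u x y p.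
       distinct [a, b, u, x, y] \<and> {a, b, u} \<inter> free_vars p = {}}"

definition ZFC :: "fm set" where
  "ZFC = {ax_extensionality, ax_foundation, ax_pairing, ax_union, ax_power, ax_infinity, ax_choice}
     \<union> ax_separation \<union> ax_replacement"

text \<open>Only the restriction of \<open>E\<close> to \<open>M\<close> matters.\<close>

definition fo_model :: "'m set \<Rightarrow> ('m \<times> 'm) set \<Rightarrow> fm set \<Rightarrow> bool" where
  "fo_model M E \<Phi> \<longleftrightarrow> M \<noteq> {} \<and> (\<forall>p\<in>\<Phi>. \<forall>s. range s \<subseteq> M \<longrightarrow> sat M E s p)"

text \<open>
  HOL cannot quantify existentially over types, so the elements of the sets \<open>U c\<close> are taken from
  one fixed type built over \<open>'m\<close>. It has room for countably many elements of type set, for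
  predicates on assignments, and for classes depending on an assignment; naming it only makes
  an existence claim stronger than existence in some type.
\<close>

type_synonym 'm universe = "nat + (nat \<Rightarrow> 'm) set + ((nat \<Rightarrow> 'm) \<times> 'm) set"

end

(*
  Set variables of set.mm are interpreted as the names of first-order variables, wffs as the
  definable sets of assignments into M, and classes as definable families of subsets of M indexed
  by assignments; the only provable wff is the set of all assignments. A wff or class depends on a
  finite set of variable names, its support, and freshness means disjointness of supports: since
  the operations do not enlarge supports, condition (2) holds, and a distinct variable condition
  says that an interpretation does not depend on a variable. So (1) reduces to the truth in M of
  the statements read as first-order formulas. This is immediate except for the two axioms that
  set.mm states differently from ZFC: its axiom of infinity, which needs a recursion inside M, and
  its axiom of choice.
*)

theory Submission
  imports Defs
begin

text \<open>Definability is forced by replacement: the wff in it must be a first-order formula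
  before the schema of \<open>M\<close> applies. Classes must then be definable in such a way that
  \<open>A = B\<close> and \<open>A \<in> B\<close> yield definable wffs again. A valuation may send
  different set variables to the same name. Statements without distinct variable conditions must
  survive such coincidences, and this is where their odd forms matter. The support of a set variable
  is the singleton of its name, so a condition on two of them says exactly that the names differ.
  Infinity asks, for every \<open>x\<close>, for a set that contains \<open>x\<close> and each of
  whose elements belongs to an element. The witness is made of \<open>x\<close>, \<open>{x}\<close>,
  \<open>{{x}}\<close> and so on. Seen from outside, \<open>M\<close> may be ill-founded, so the
  stages cannot be indexed by true natural numbers: being a value at stage \<open>n\<close> has to
  be a formula evaluated in \<open>M\<close>.\<close>

section \<open>Satisfaction of first-order formulas\<close>

lemma finite_free_vars: "finite (free_vars p)"
  by (induction p) auto

lemma sat_cong: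
  "(\<And>v. v \<in> free_vars p \<Longrightarrow> s v = t v) \<Longrightarrow> sat M E s p \<longleftrightarrow> sat M E t p"
proof (induction p arbitrary: s t)
  case (FAll x p)
  have "sat M E (s(x := m)) p \<longleftrightarrow> sat M E (t(x := m)) p" for m
    by (rule FAll.IH) (use FAll.prems in auto)
  then show ?case by simp
next
  case (FNot p)
  then show ?case by (metis free_vars.simps(3) sat.simps(3))
next
  case (FImp p q)
  then show ?case by (metis UnI1 UnI2 free_vars.simps(4) sat.simps(4))
qed auto

lemma sat_FNot:
  "sat M E s (\<not>\<^sub>f (x \<in>\<^sub>f y)) \<longleftrightarrow> (s x, s y) \<notin> E"
  "sat M E s (\<not>\<^sub>f (x =\<^sub>f y)) \<longleftrightarrow> s x \<noteq> s y"
  "sat M E s (\<not>\<^sub>f \<not>\<^sub>f p) \<longleftrightarrow> sat M E s p"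
  "sat M E s (\<not>\<^sub>f (p \<rightarrow>\<^sub>f q)) \<longleftrightarrow> sat M E s p \<and> sat M E s (\<not>\<^sub>f q)"
  "sat M E s (\<not>\<^sub>f (\<forall>\<^sub>f x. p)) \<longleftrightarrow> (\<exists>m\<in>M. sat M E (s(x := m)) (\<not>\<^sub>f p))"
  by auto

text \<open>
  Negation is pushed inwards so that no two rules for \<open>sat\<close> overlap; \<open>\<or>\<^sub>f\<close> and \<open>\<leftrightarrow>\<^sub>f\<close> abbreviate
  implications and are recovered by the last two logical rules.
\<close>

lemmas sat_eval = sat.simps(1,2,4,5) sat_FNot iff_conv_conj_imp[symmetric] disj_imp[symmetric]
  fun_upd_apply if_True if_False numeral_eq_iff num.distinct num.inject zero_neq_numeral numeral_neq_zero
  zero_neq_one one_neq_zero one_eq_numeral_iff numeral_eq_one_iff simp_thms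

locale zfc_model =
  fixes M :: "'m set" and E :: "('m \<times> 'm) set"
  assumes model: "fo_model M E ZFC"
begin

section \<open>Set theory inside the model\<close>

definition Ass :: "(nat \<Rightarrow> 'm) set" where
  "Ass = {s. range s \<subseteq> M}"

lemma Ass_upd [simp]: "s \<in> Ass \<Longrightarrow> m \<in> M \<Longrightarrow> s(x := m) \<in> Ass"
  by (auto simp: Ass_def)

lemma Ass_in: "s \<in> Ass \<Longrightarrow> s x \<in> M"
  by (auto simp: Ass_def)

lemma const_Ass: "m \<in> M \<Longrightarrow> (\<lambda>_. m) \<in> Ass"
  by (auto simp: Ass_def)

lemma Ass_nonempty: "Ass \<noteq> {}"
  using model const_Ass unfolding fo_model_def by blast

lemma sat_ZFC: "p \<in> ZFC \<Longrightarrow> s \<in> Ass \<Longrightarrow> sat M E s p"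
  using model unfolding fo_model_def Ass_def by blast

section \<open>The axioms of ZFC as facts about \<open>M\<close> and \<open>E\<close>\<close>

lemma extensionality:
  assumes "a \<in> M" "b \<in> M" "\<And>c. c \<in> M \<Longrightarrow> (c, a) \<in> E \<longleftrightarrow> (c, b) \<in> E"
  shows "a = b"
proof -
  \<comment> \<open>The axiom is a sentence, so any assignment into \<open>M\<close> will do; the
    constant one is at hand.\<close>
  have "sat M E (\<lambda>_. a) ax_extensionality"
    by (rule sat_ZFC) (simp_all add: ZFC_def assms const_Ass)
  then have "\<forall>a\<in>M. \<forall>b\<in>M. (\<forall>c\<in>M. (c, a) \<in> E \<longleftrightarrow> (c, b) \<in> E) \<longrightarrow> a = b"
    by (simp only: ax_extensionality_def sat_eval)
  then show ?thesis using assms by blast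
qed

lemma foundation:
  assumes "a \<in> M" "b \<in> M" "(b, a) \<in> E"
  obtains c where "c \<in> M" "(c, a) \<in> E" "\<And>d. d \<in> M \<Longrightarrow> (d, a) \<in> E \<Longrightarrow> (d, c) \<notin> E"
proof -
  have "sat M E (\<lambda>_. a) ax_foundation"
    by (rule sat_ZFC) (simp_all add: ZFC_def assms const_Ass)
  then have "\<forall>a\<in>M. (\<exists>b\<in>M. (b, a) \<in> E) \<longrightarrow>
      (\<exists>c\<in>M. (c, a) \<in> E \<and> (\<forall>d\<in>M. (d, a) \<in> E \<longrightarrow> (d, c) \<notin> E))"
    by (simp only: ax_foundation_def sat_eval)
  from bspec[OF this assms(1)] assms show ?thesis using that by blast
qed

lemma pairing:
  assumes "a \<in> M" "b \<in> M"
  obtains c where "c \<in> M" "\<And>d. d \<in> M \<Longrightarrow> (d, c) \<in> E \<longleftrightarrow> d = a \<or> d = b"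
proof -
  have "sat M E (\<lambda>_. a) ax_pairing"
    by (rule sat_ZFC) (simp_all add: ZFC_def assms const_Ass)
  then have "\<forall>a\<in>M. \<forall>b\<in>M. \<exists>c\<in>M. \<forall>d\<in>M. (d, c) \<in> E \<longleftrightarrow> d = a \<or> d = b"
    by (simp only: ax_pairing_def sat_eval)
  from bspec[OF bspec[OF this assms(1)] assms(2)] show ?thesis using that by (elim bexE) simp
qed

lemma union:
  assumes "a \<in> M"
  obtains c where "c \<in> M" "\<And>d. d \<in> M \<Longrightarrow> (d, c) \<in> E \<longleftrightarrow> (\<exists>b\<in>M. (d, b) \<in> E \<and> (b, a) \<in> E)"
proof -
  have "sat M E (\<lambda>_. a) ax_union"
    by (rule sat_ZFC) (simp_all add: ZFC_def assms const_Ass)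
  then have "\<forall>a\<in>M. \<exists>c\<in>M. \<forall>d\<in>M. (d, c) \<in> E \<longleftrightarrow> (\<exists>b\<in>M. (d, b) \<in> E \<and> (b, a) \<in> E)"
    by (simp only: ax_union_def sat_eval)
  from bspec[OF this assms] show ?thesis using that by (elim bexE) simp
qed

lemma power:
  assumes "a \<in> M"
  obtains c where "c \<in> M"
    "\<And>d. d \<in> M \<Longrightarrow> (d, c) \<in> E \<longleftrightarrow> (\<forall>b\<in>M. (b, d) \<in> E \<longrightarrow> (b, a) \<in> E)"
proof -
  have "sat M E (\<lambda>_. a) ax_power"
    by (rule sat_ZFC) (simp_all add: ZFC_def assms const_Ass)
  then have "\<forall>a\<in>M. \<exists>c\<in>M. \<forall>d\<in>M. (d, c) \<in> E \<longleftrightarrow> (\<forall>b\<in>M. (b, d) \<in> E \<longrightarrow> (b, a) \<in> E)"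
    by (simp only: ax_power_def sat_eval)
  from bspec[OF this assms] show ?thesis using that by (elim bexE) simp
qed

lemma choice:
  assumes "a \<in> M"
    and ne: "\<And>b. b \<in> M \<Longrightarrow> (b, a) \<in> E \<Longrightarrow> \<exists>c\<in>M. (c, b) \<in> E"
    and disj: "\<And>b c d. \<lbrakk>b \<in> M; c \<in> M; d \<in> M; (b, a) \<in> E; (c, a) \<in> E; (d, b) \<in> E; (d, c) \<in> E\<rbrakk> \<Longrightarrow> b = c"
  obtains e where "e \<in> M"
    "\<And>b. b \<in> M \<Longrightarrow> (b, a) \<in> E \<Longrightarrow> \<exists>c\<in>M. \<forall>d\<in>M. (d, b) \<in> E \<and> (d, e) \<in> E \<longleftrightarrow> d = c"
proof -
  have "sat M E (\<lambda>_. a) ax_choice"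
    by (rule sat_ZFC) (simp_all add: ZFC_def assms const_Ass)
  then have "\<forall>a\<in>M. (\<forall>b\<in>M. (b, a) \<in> E \<longrightarrow> (\<exists>c\<in>M. (c, b) \<in> E)) \<and>
      (\<forall>b\<in>M. \<forall>c\<in>M. (b, a) \<in> E \<and> (c, a) \<in> E \<and> b \<noteq> c \<longrightarrow> (\<forall>d\<in>M. (d, b) \<in> E \<longrightarrow> (d, c) \<notin> E)) \<longrightarrow>
      (\<exists>e\<in>M. \<forall>b\<in>M. (b, a) \<in> E \<longrightarrow> (\<exists>c\<in>M. \<forall>d\<in>M. (d, b) \<in> E \<and> (d, e) \<in> E \<longleftrightarrow> d = c))"
    by (simp only: ax_choice_def sat_eval)
  note transversal = bspec[OF this assms(1), THEN mp]
  have "\<exists>e\<in>M. \<forall>b\<in>M. (b, a) \<in> E \<longrightarrow> (\<exists>c\<in>M. \<forall>d\<in>M. (d, b) \<in> E \<and> (d, e) \<in> E \<longleftrightarrow> d = c)"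
    by (rule transversal, intro conjI ballI impI) (use ne disj in blast)+
  then obtain e where e: "e \<in> M"
    "\<forall>b\<in>M. (b, a) \<in> E \<longrightarrow> (\<exists>c\<in>M. \<forall>d\<in>M. (d, b) \<in> E \<and> (d, e) \<in> E \<longleftrightarrow> d = c)"
    by (rule bexE)
  show ?thesis by (rule that[OF e(1) bspec[OF e(2), THEN mp]])
qed

section \<open>Small sets, successors and ordered pairs as relations on \<open>M\<close>\<close>

definition is_empty :: "'m \<Rightarrow> bool" where
  "is_empty n \<longleftrightarrow> (\<forall>t\<in>M. (t, n) \<notin> E)"

definition is_succ :: "'m \<Rightarrow> 'm \<Rightarrow> bool" where
  "is_succ n m \<longleftrightarrow> (\<forall>t\<in>M. (t, n) \<in> E \<longleftrightarrow> (t, m) \<in> E \<or> t = m)"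

definition is_sing :: "'m \<Rightarrow> 'm \<Rightarrow> bool" where
  "is_sing z v \<longleftrightarrow> (\<forall>t\<in>M. (t, z) \<in> E \<longleftrightarrow> t = v)"

definition is_upair :: "'m \<Rightarrow> 'm \<Rightarrow> 'm \<Rightarrow> bool" where
  "is_upair q a b \<longleftrightarrow> (\<forall>t\<in>M. (t, q) \<in> E \<longleftrightarrow> t = a \<or> t = b)"

text \<open>Kuratowski's \<open>{{a}, {a, b}}\<close>. It is a relation and not an operation so that
  it can be copied into a formula, \<open>fm_pair\<close>, when replacement needs one.\<close>

definition is_pair :: "'m \<Rightarrow> 'm \<Rightarrow> 'm \<Rightarrow> bool" where
  "is_pair q a b \<longleftrightarrow> (\<forall>r\<in>M. (r, q) \<in> E \<longleftrightarrow> is_sing r a \<or> is_upair r a b)"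

lemma infinity:
  obtains I e where "I \<in> M" "e \<in> M" "(e, I) \<in> E" "is_empty e"
    "\<And>m. m \<in> M \<Longrightarrow> (m, I) \<in> E \<Longrightarrow> \<exists>n\<in>M. (n, I) \<in> E \<and> is_succ n m"
proof -
  obtain m where "m \<in> M" using model unfolding fo_model_def by blast
  then have "sat M E (\<lambda>_. m) ax_infinity"
    by (intro sat_ZFC) (simp_all add: ZFC_def const_Ass)
  then have "\<exists>I\<in>M. (\<exists>e\<in>M. (e, I) \<in> E \<and> is_empty e) \<and>
     (\<forall>m\<in>M. (m, I) \<in> E \<longrightarrow> (\<exists>n\<in>M. (n, I) \<in> E \<and> is_succ n m))"
    by (simp only: ax_infinity_def is_empty_def is_succ_def sat_eval)
  then show ?thesis using that by blast
qed

text \<open>The schema demands names \<open>k\<close>, \<open>l\<close>, \<open>u\<close> that are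
  not free in \<open>p\<close>; they exist because \<open>p\<close> has finitely many free
  variables. Parameters of \<open>p\<close> take their values from \<open>s\<close>.\<close>

lemma replacement:
  assumes s: "s \<in> Ass" and a: "a \<in> M" and xy: "x \<noteq> y"
    and fn: "\<And>m. m \<in> M \<Longrightarrow> \<exists>u\<in>M. \<forall>n\<in>M. sat M E (s(x := m, y := n)) p \<longrightarrow> n = u"
  obtains b where "b \<in> M"
    "\<And>n. n \<in> M \<Longrightarrow> (n, b) \<in> E \<longleftrightarrow> (\<exists>m\<in>M. (m, a) \<in> E \<and> sat M E (s(x := m, y := n)) p)"
proof -
  define V where "V = free_vars p \<union> {x, y}"
  have fV: "finite V" unfolding V_def by (simp add: finite_free_vars)
  obtain k where k: "k \<notin> V"
    using fV ex_new_if_finite[OF infinite_UNIV_nat] by blast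
  obtain l where l: "l \<notin> insert k V"
    using fV ex_new_if_finite[OF infinite_UNIV_nat, of "insert k V"] by blast
  obtain u where u: "u \<notin> insert l (insert k V)"
    using fV ex_new_if_finite[OF infinite_UNIV_nat, of "insert l (insert k V)"] by blast
  have irr: "sat M E t p \<longleftrightarrow> sat M E (s(x := t x, y := t y)) p"
    if "\<And>v. v \<in> V \<Longrightarrow> v \<noteq> x \<Longrightarrow> v \<noteq> y \<Longrightarrow> t v = s v" for t
    by (rule sat_cong) (use that in \<open>auto simp: V_def\<close>)
  define rep where "rep = ((\<forall>\<^sub>f x. \<exists>\<^sub>f u. \<forall>\<^sub>f y. p \<rightarrow>\<^sub>f y =\<^sub>f u)
       \<rightarrow>\<^sub>f (\<forall>\<^sub>f k. \<exists>\<^sub>f l. \<forall>\<^sub>f y. y \<in>\<^sub>f l \<leftrightarrow>\<^sub>f (\<exists>\<^sub>f x. x \<in>\<^sub>f k \<and>\<^sub>f p)))"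
  have dist: "distinct [k, l, u, x, y]" "{k, l, u} \<inter> free_vars p = {}"
    using k l u xy by (auto simp: V_def)
  then have "rep \<in> ZFC"
    unfolding ZFC_def ax_replacement_def rep_def by blast
  then have "sat M E s rep" using s by (rule sat_ZFC)
  moreover have irr1: "sat M E (s(x := m, u := v, y := n)) p \<longleftrightarrow> sat M E (s(x := m, y := n)) p"
    for m n v
    using dist by (subst irr) (auto simp: V_def)
  moreover have irr2:
    "sat M E (s(k := v, l := w, y := n, x := m)) p \<longleftrightarrow> sat M E (s(x := m, y := n)) p" for m n v w
    using dist by (subst irr) (auto simp: V_def)
  \<comment> \<open>In this form the inequalities decide the tests that \<open>fun_upd_apply\<close>
    leaves behind.\<close>
  moreover have "(x = y) = False" "(y = x) = False" "(u = y) = False" "(y = u) = False"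
    "(k = y) = False" "(k = l) = False" "(k = x) = False" "(l = y) = False" "(x = k) = False"
    using dist(1) by auto
  ultimately have "(\<forall>m\<in>M. \<exists>u\<in>M. \<forall>n\<in>M. sat M E (s(x := m, y := n)) p \<longrightarrow> n = u) \<longrightarrow>
      (\<forall>a\<in>M. \<exists>b\<in>M. \<forall>n\<in>M. (n, b) \<in> E \<longleftrightarrow> (\<exists>m\<in>M. (m, a) \<in> E \<and> sat M E (s(x := m, y := n)) p))"
    by (simp only: rep_def sat_eval)
  then have "\<exists>b\<in>M. \<forall>n\<in>M. (n, b) \<in> E \<longleftrightarrow> (\<exists>m\<in>M. (m, a) \<in> E \<and> sat M E (s(x := m, y := n)) p)"
    using fn a by blast
  then show ?thesis using that by blast
qed

lemma separation:
  assumes s: "s \<in> Ass" and a: "a \<in> M"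
  obtains b where "b \<in> M"
    "\<And>n. n \<in> M \<Longrightarrow> (n, b) \<in> E \<longleftrightarrow> (n, a) \<in> E \<and> sat M E (s(y := n)) p"
proof -
  define V where "V = insert y (free_vars p)"
  have fV: "finite V" unfolding V_def by (simp add: finite_free_vars)
  obtain k where k: "k \<notin> V"
    using fV ex_new_if_finite[OF infinite_UNIV_nat] by blast
  obtain l where l: "l \<notin> insert k V"
    using fV ex_new_if_finite[OF infinite_UNIV_nat, of "insert k V"] by blast
  define sep where "sep = (\<forall>\<^sub>f k. \<exists>\<^sub>f l. \<forall>\<^sub>f y. y \<in>\<^sub>f l \<leftrightarrow>\<^sub>f (y \<in>\<^sub>f k \<and>\<^sub>f p))"
  have dist: "distinct [k, l, y]" "l \<notin> free_vars p" "k \<notin> free_vars p"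
    using k l by (auto simp: V_def)
  then have "sep \<in> ZFC"
    unfolding ZFC_def ax_separation_def sep_def by blast
  then have "sat M E s sep" using s by (rule sat_ZFC)
  moreover have "sat M E (s(k := v, l := w, y := n)) p \<longleftrightarrow> sat M E (s(y := n)) p" for n v w
    by (rule sat_cong) (use dist in auto)
  moreover have "(k = y) = False" "(k = l) = False" "(l = y) = False"
    using dist(1) by auto
  ultimately have "\<forall>a\<in>M. \<exists>b\<in>M. \<forall>n\<in>M. (n, b) \<in> E \<longleftrightarrow> (n, a) \<in> E \<and> sat M E (s(y := n)) p"
    by (simp only: sep_def sat_eval)
  then show ?thesis using that a by blast
qed

section \<open>Pairs, binary unions and consequences of foundation\<close>

lemma upair_exists:
  assumes "a \<in> M" "b \<in> M" obtains c where "c \<in> M" "is_upair c a b"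
  using pairing[OF assms] unfolding is_upair_def by metis

lemma sing_exists:
  assumes "a \<in> M" obtains c where "c \<in> M" "is_sing c a"
  using pairing[OF assms assms] unfolding is_sing_def by metis

lemma pair_exists:
  assumes "a \<in> M" "b \<in> M" obtains c where "c \<in> M" "is_pair c a b"
proof -
  obtain S where S: "S \<in> M" "is_sing S a" using sing_exists assms by blast
  obtain T where T: "T \<in> M" "is_upair T a b" using upair_exists assms by blast
  obtain c where c: "c \<in> M" "\<And>d. d \<in> M \<Longrightarrow> (d, c) \<in> E \<longleftrightarrow> d = S \<or> d = T"
    using pairing S(1) T(1) by blast
  \<comment> \<open>By extensionality \<open>S\<close> is the only singleton of \<open>a\<close>;
    the same is done for \<open>T\<close> below.\<close>
  have "d = S \<longleftrightarrow> is_sing d a" if "d \<in> M" for d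
    using S that extensionality[of d S] unfolding is_sing_def by blast
  moreover have "d = T \<longleftrightarrow> is_upair d a b" if "d \<in> M" for d
    using T that extensionality[of d T] unfolding is_upair_def by blast
  ultimately show ?thesis using that[OF c(1)] c(2) unfolding is_pair_def by blast
qed

lemma pair_inj:
  assumes M: "a \<in> M" "b \<in> M" "a' \<in> M" "b' \<in> M" and p: "is_pair q a b" "is_pair q a' b'"
  shows "a = a' \<and> b = b'"
proof -
  obtain S where S: "S \<in> M" "is_sing S a" using sing_exists M by blast
  obtain T where T: "T \<in> M" "is_upair T a b" using upair_exists M by blast
  obtain T' where T': "T' \<in> M" "is_upair T' a' b'" using upair_exists M by blast
  \<comment> \<open>\<open>{a}\<close>, \<open>{a, b}\<close> and \<open>{a', b'}\<close> are
    members of \<open>q\<close>, so each also fits the other description. The first gives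
    \<open>a = a'\<close>; the other two compare \<open>b\<close> with \<open>b'\<close>.\<close>
  have "is_sing S a' \<or> is_upair S a' b'" "is_sing T a' \<or> is_upair T a' b'"
    "is_sing T' a \<or> is_upair T' a b"
    using S T T' p unfolding is_pair_def by blast+
  then show ?thesis
    using S(2) T(2) T'(2) M unfolding is_sing_def is_upair_def by metis
qed

lemma binary_union:
  assumes "a \<in> M" "b \<in> M"
  obtains c where "c \<in> M" "\<And>d. d \<in> M \<Longrightarrow> (d, c) \<in> E \<longleftrightarrow> (d, a) \<in> E \<or> (d, b) \<in> E"
proof -
  obtain p where p: "p \<in> M" "\<And>d. d \<in> M \<Longrightarrow> (d, p) \<in> E \<longleftrightarrow> d = a \<or> d = b"
    using pairing assms by blast
  obtain c where c: "c \<in> M" "\<And>d. d \<in> M \<Longrightarrow> (d, c) \<in> E \<longleftrightarrow> (\<exists>b\<in>M. (d, b) \<in> E \<and> (b, p) \<in> E)"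
    using union p(1) by blast
  show ?thesis
    by (rule that[OF c(1)]) (use c p assms in auto)
qed

text \<open>Foundation for \<open>{a, b}\<close>; with \<open>a = b\<close> it also excludes
  self-membership.\<close>

lemma no_two_cycle:
  assumes "a \<in> M" "b \<in> M" "(a, b) \<in> E" shows "(b, a) \<notin> E"
proof
  assume *: "(b, a) \<in> E"
  obtain p where p: "p \<in> M" "\<And>d. d \<in> M \<Longrightarrow> (d, p) \<in> E \<longleftrightarrow> d = a \<or> d = b"
    using pairing assms by blast
  then obtain c where "c \<in> M" "(c, p) \<in> E" "\<And>d. d \<in> M \<Longrightarrow> (d, p) \<in> E \<Longrightarrow> (d, c) \<notin> E"
    using foundation[of p a] assms by blast
  then show False using p assms * by blast
qed

text \<open>Two different elements with a common successor would be members of each other.\<close>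

lemma succ_inj:
  assumes "m \<in> M" "m' \<in> M" "is_succ n m" "is_succ n m'" shows "m = m'"
  using assms no_two_cycle[of m m'] unfolding is_succ_def by blast

text \<open>
  Every element of \<open>F\<close> is a pair \<open>\<langle>n, {\<cdots>{x}\<cdots>}\<rangle>\<close> with \<open>n\<close> braces, justified by its predecessor in \<open>F\<close>.
  Such an \<open>F\<close> need not be a function, so no recursion theorem is required.
\<close>

definition justified :: "'m \<Rightarrow> 'm \<Rightarrow> 'm \<Rightarrow> 'm \<Rightarrow> bool" where
  "justified x F n z \<longleftrightarrow> is_empty n \<and> z = x \<or>
     (\<exists>m\<in>M. \<exists>v\<in>M. \<exists>r\<in>M. (r, F) \<in> E \<and> is_pair r m v \<and> is_succ n m \<and> is_sing z v)"

definition chain :: "'m \<Rightarrow> 'm \<Rightarrow> bool" where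
  "chain x F \<longleftrightarrow>
     (\<forall>q\<in>M. (q, F) \<in> E \<longrightarrow> (\<exists>n\<in>M. \<exists>z\<in>M. is_pair q n z \<and> justified x F n z))"

text \<open>The quantifier over \<open>F\<close> spares the construction of one function on the
  whole inductive set: every value brings its own certificate.\<close>

definition iter_sing :: "'m \<Rightarrow> 'm \<Rightarrow> 'm \<Rightarrow> bool" where
  "iter_sing x n z \<longleftrightarrow> (\<exists>F\<in>M. chain x F \<and> (\<exists>q\<in>M. (q, F) \<in> E \<and> is_pair q n z))"

section \<open>Recursion equations for iterated singletons\<close>

lemma justified_mono:
  assumes "justified x F n z" "\<And>r. r \<in> M \<Longrightarrow> (r, F) \<in> E \<Longrightarrow> (r, G) \<in> E"
  shows "justified x G n z"
  using assms unfolding justified_def by meson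

text \<open>Adjoin the pair of \<open>n\<close> and \<open>z\<close> to \<open>F\<close>.
  Justification is monotone in \<open>F\<close>, so the old entries stay justified, and
  \<open>F\<close> itself justifies the new one.\<close>

lemma chain_extend:
  assumes F: "F \<in> M" "chain x F" and nz: "n \<in> M" "z \<in> M" and just: "justified x F n z"
  shows "iter_sing x n z"
proof -
  obtain q where q: "q \<in> M" "is_pair q n z" using pair_exists nz by blast
  obtain S where S: "S \<in> M" "is_sing S q" using sing_exists q(1) by blast
  obtain G where G: "G \<in> M" "\<And>d. d \<in> M \<Longrightarrow> (d, G) \<in> E \<longleftrightarrow> (d, F) \<in> E \<or> (d, S) \<in> E"
    using binary_union F(1) S(1) by blast
  have G': "(d, G) \<in> E \<longleftrightarrow> (d, F) \<in> E \<or> d = q" if "d \<in> M" for d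
    using G(2)[OF that] S(2) that unfolding is_sing_def by simp
  have mono: "justified x F a b \<Longrightarrow> justified x G a b" for a b
    by (erule justified_mono) (simp add: G')
  have "\<exists>n\<in>M. \<exists>z\<in>M. is_pair r n z \<and> justified x G n z" if r: "r \<in> M" "(r, G) \<in> E" for r
  proof (cases "r = q")
    case True
    then show ?thesis using nz just q mono by blast
  next
    case False
    then have "(r, F) \<in> E" using G' r by blast
    then show ?thesis using F(2) r(1) mono unfolding chain_def by meson
  qed
  then have "chain x G" unfolding chain_def by blast
  moreover have "(q, G) \<in> E" using G' q(1) by blast
  ultimately show ?thesis using G(1) q unfolding iter_sing_def by blast
qed

text \<open>The entry that justifies the value at \<open>n\<close> lies in the same
  \<open>F\<close>, so \<open>F\<close> also certifies the value at the predecessor.\<close>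

lemma iter_sing_cases:
  assumes "n \<in> M" "z \<in> M" "iter_sing x n z"
  shows "is_empty n \<and> z = x \<or> (\<exists>m\<in>M. \<exists>v\<in>M. iter_sing x m v \<and> is_succ n m \<and> is_sing z v)"
proof -
  obtain F q where F: "F \<in> M" "chain x F" "q \<in> M" "(q, F) \<in> E" "is_pair q n z"
    using assms(3) unfolding iter_sing_def by blast
  then obtain n' z' where nz: "n' \<in> M" "z' \<in> M" "is_pair q n' z'" "justified x F n' z'"
    unfolding chain_def by meson
  have "n' = n \<and> z' = z" using pair_inj[OF nz(1,2) assms(1,2) nz(3) F(5)] .
  then have "justified x F n z" using nz(4) by simp
  moreover have "iter_sing x m v" if "r \<in> M" "(r, F) \<in> E" "is_pair r m v" for r m v
    using that F(1,2) unfolding iter_sing_def by meson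
  ultimately show ?thesis unfolding justified_def by meson
qed

lemma iter_sing_empty:
  assumes "x \<in> M" "n \<in> M" "is_empty n" "z \<in> M"
  shows "iter_sing x n z \<longleftrightarrow> z = x"
proof
  assume "iter_sing x n z"
  from iter_sing_cases[OF assms(2,4) this] show "z = x"
    using assms unfolding is_empty_def is_succ_def by blast
next
  assume "z = x"
  \<comment> \<open>The empty element \<open>n\<close> doubles as the chain without entries.\<close>
  have "chain x n" using assms(3) unfolding chain_def is_empty_def by blast
  moreover have "justified x n n z" using assms(3) \<open>z = x\<close> unfolding justified_def by blast
  ultimately show "iter_sing x n z" using chain_extend assms by blast
qed

text \<open>Injectivity of the successor identifies the predecessor recorded in \<open>F\<close>
  with \<open>m\<close>. Both recursion equations hold without any induction on
  \<open>n\<close>.\<close>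

lemma iter_sing_succ:
  assumes "n \<in> M" "m \<in> M" "is_succ n m" "z \<in> M"
  shows "iter_sing x n z \<longleftrightarrow> (\<exists>v\<in>M. iter_sing x m v \<and> is_sing z v)"
proof
  assume "iter_sing x n z"
  from iter_sing_cases[OF assms(1,4) this] show "\<exists>v\<in>M. iter_sing x m v \<and> is_sing z v"
  proof
    assume "is_empty n \<and> z = x"
    then show ?thesis using assms unfolding is_empty_def is_succ_def by blast
  next
    assume "\<exists>m\<in>M. \<exists>v\<in>M. iter_sing x m v \<and> is_succ n m \<and> is_sing z v"
    then obtain m' v where "m' \<in> M" "v \<in> M" "iter_sing x m' v" "is_succ n m'" "is_sing z v"
      by blast
    then show ?thesis using succ_inj[of m' m n] assms by blast
  qed
next
  assume "\<exists>v\<in>M. iter_sing x m v \<and> is_sing z v"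
  then obtain v F q where "v \<in> M" "is_sing z v" "F \<in> M" "chain x F" "q \<in> M" "(q, F) \<in> E"
    "is_pair q m v"
    unfolding iter_sing_def by blast
  moreover from this have "justified x F n z" using assms unfolding justified_def by blast
  ultimately show "iter_sing x n z" using chain_extend assms by blast
qed

section \<open>Formulas for these relations\<close>

text \<open>
  The variables from \<open>8\<close> on are reserved for bound variables; \<open>fm_chain\<close> and \<open>fm_iter_sing\<close> expect
  the starting point \<open>x\<close> in variable \<open>2\<close>.
\<close>

definition "fm_sing z v = (\<forall>\<^sub>f 20. 20 \<in>\<^sub>f z \<leftrightarrow>\<^sub>f 20 =\<^sub>f v)"
definition "fm_upair q a b = (\<forall>\<^sub>f 20. 20 \<in>\<^sub>f q \<leftrightarrow>\<^sub>f (20 =\<^sub>f a \<or>\<^sub>f 20 =\<^sub>f b))"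
definition "fm_succ n m = (\<forall>\<^sub>f 20. 20 \<in>\<^sub>f n \<leftrightarrow>\<^sub>f (20 \<in>\<^sub>f m \<or>\<^sub>f 20 =\<^sub>f m))"
definition "fm_empty n = (\<forall>\<^sub>f 20. \<not>\<^sub>f 20 \<in>\<^sub>f n)"
definition "fm_pair q a b = (\<forall>\<^sub>f 19. 19 \<in>\<^sub>f q \<leftrightarrow>\<^sub>f (fm_sing 19 a \<or>\<^sub>f fm_upair 19 a b))"

lemma sat_fm_sing:
  "(z = 20) = False \<Longrightarrow> (v = 20) = False \<Longrightarrow> sat M E s (fm_sing z v) \<longleftrightarrow> is_sing (s z) (s v)"
  by (simp only: fm_sing_def is_sing_def sat_eval)

lemma sat_fm_upair:
  "(q = 20) = False \<Longrightarrow> (a = 20) = False \<Longrightarrow> (b = 20) = False \<Longrightarrow>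
   sat M E s (fm_upair q a b) \<longleftrightarrow> is_upair (s q) (s a) (s b)"
  by (simp only: fm_upair_def is_upair_def sat_eval)

lemma sat_fm_succ:
  "(n = 20) = False \<Longrightarrow> (m = 20) = False \<Longrightarrow> sat M E s (fm_succ n m) \<longleftrightarrow> is_succ (s n) (s m)"
  by (simp only: fm_succ_def is_succ_def sat_eval)

lemma sat_fm_empty: "(n = 20) = False \<Longrightarrow> sat M E s (fm_empty n) \<longleftrightarrow> is_empty (s n)"
  by (simp only: fm_empty_def is_empty_def sat_eval)

lemma sat_FNot_fm_sing:
  "(z = 20) = False \<Longrightarrow> (v = 20) = False \<Longrightarrow> sat M E s (\<not>\<^sub>f fm_sing z v) \<longleftrightarrow> \<not> is_sing (s z) (s v)"
  by (simp only: sat.simps(3) sat_fm_sing)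

lemma sat_fm_pair:
  "(q = 20) = False \<Longrightarrow> (a = 20) = False \<Longrightarrow> (b = 20) = False \<Longrightarrow>
   (q = 19) = False \<Longrightarrow> (a = 19) = False \<Longrightarrow> (b = 19) = False \<Longrightarrow>
   sat M E s (fm_pair q a b) \<longleftrightarrow> is_pair (s q) (s a) (s b)"
  by (simp only: fm_pair_def is_pair_def sat_eval sat_fm_sing sat_FNot_fm_sing sat_fm_upair)

lemmas sat_fm = sat_fm_sing sat_fm_upair sat_fm_succ sat_fm_empty sat_fm_pair

text \<open>The set \<open>F\<close> is read from variable 8, which \<open>fm_iter_sing\<close>
  binds.\<close>

definition "fm_chain = (\<forall>\<^sub>f 10. 10 \<in>\<^sub>f 8 \<rightarrow>\<^sub>f (\<exists>\<^sub>f 11. \<exists>\<^sub>f 12. fm_pair 10 11 12 \<and>\<^sub>f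
     ((fm_empty 11 \<and>\<^sub>f 12 =\<^sub>f 2) \<or>\<^sub>f
      (\<exists>\<^sub>f 13. \<exists>\<^sub>f 14. \<exists>\<^sub>f 15. 15 \<in>\<^sub>f 8 \<and>\<^sub>f fm_pair 15 13 14 \<and>\<^sub>f fm_succ 11 13 \<and>\<^sub>f fm_sing 12 14))))"

lemma sat_fm_chain: "sat M E s fm_chain \<longleftrightarrow> chain (s 2) (s 8)"
proof -
  \<comment> \<open>The rule for double negation dissolves the conjunction to the left of
    \<open>\<or>\<^sub>f\<close>; this equation supplies the shape that remains.\<close>
  have "is_empty n \<and> p \<or> q \<longleftrightarrow> (is_empty n \<longrightarrow> \<not> p) \<longrightarrow> q" for n p q
    by blast
  then show ?thesis
    by (simp only: fm_chain_def chain_def justified_def sat_eval sat_fm)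
qed

definition "fm_iter_sing n z = (\<exists>\<^sub>f 8. fm_chain \<and>\<^sub>f (\<exists>\<^sub>f 9. 9 \<in>\<^sub>f 8 \<and>\<^sub>f fm_pair 9 n z))"

lemma sat_fm_iter_sing:
  assumes "n < 8" "z < 8"
  shows "sat M E s (fm_iter_sing n z) \<longleftrightarrow> iter_sing (s 2) (s n) (s z)"
proof -
  have "(n = 8) = False" "(n = 9) = False" "(n = 19) = False" "(n = 20) = False"
    "(z = 8) = False" "(z = 9) = False" "(z = 19) = False" "(z = 20) = False"
    using assms by auto
  then show ?thesis
    by (simp only: fm_iter_sing_def iter_sing_def sat_eval sat_fm sat_fm_chain)
qed

text \<open>
  The sequence \<open>x, {x}, {{x}}, \<dots>\<close> is a set by replacement. The inductive set \<open>I\<close> may be larger than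
  \<open>\<omega>\<close>, so only those \<open>n\<close> are used at which \<open>iter_sing x n\<close> has exactly one value.
\<close>

lemma cofinal_set_exists:
  assumes x: "x \<in> M"
  shows "\<exists>y\<in>M. (x, y) \<in> E \<and> (\<forall>z\<in>M. (z, y) \<in> E \<longrightarrow> (\<exists>w\<in>M. (z, w) \<in> E \<and> (w, y) \<in> E))"
proof -
  obtain I e where I: "I \<in> M" "e \<in> M" "(e, I) \<in> E" "is_empty e"
    "\<And>m. m \<in> M \<Longrightarrow> (m, I) \<in> E \<Longrightarrow> \<exists>n\<in>M. (n, I) \<in> E \<and> is_succ n m"
    using infinity by blast
  define G where "G n z \<longleftrightarrow> (\<forall>w\<in>M. iter_sing x n w \<longleftrightarrow> w = z)" for n z
  \<comment> \<open>The constant assignment leaves \<open>x\<close> in variable 2, where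
    \<open>fm_iter_sing\<close> expects it; variables 0 and 1 hold index and value.\<close>
  have sat_G: "sat M E ((\<lambda>_. x)(0 := n, 1 := z)) (\<forall>\<^sub>f 3. fm_iter_sing 0 3 \<leftrightarrow>\<^sub>f 3 =\<^sub>f 1) \<longleftrightarrow> G n z" for n z
    by (simp only: G_def sat_eval) (simp add: sat_fm_iter_sing)
  have G_unique: "z = w" if "G n z" "G n w" "z \<in> M" for n z w
    using that unfolding G_def by blast
  obtain y where y: "y \<in> M"
    "\<And>z. z \<in> M \<Longrightarrow> (z, y) \<in> E \<longleftrightarrow> (\<exists>n\<in>M. (n, I) \<in> E \<and> G n z)"
  proof (rule replacement[of "\<lambda>_. x" I 0 1 "\<forall>\<^sub>f 3. fm_iter_sing 0 3 \<leftrightarrow>\<^sub>f 3 =\<^sub>f 1"])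
    show "\<exists>u\<in>M. \<forall>z\<in>M. sat M E ((\<lambda>_. x)(0 := n, 1 := z)) (\<forall>\<^sub>f 3. fm_iter_sing 0 3 \<leftrightarrow>\<^sub>f 3 =\<^sub>f 1) \<longrightarrow> z = u"
      for n
      unfolding sat_G using x G_unique by (cases "\<exists>z\<in>M. G n z") blast+
  qed (use x I(1) in \<open>simp_all only: sat_G const_Ass zero_neq_one simp_thms\<close>)
  have "G e x" unfolding G_def using iter_sing_empty x I by blast
  then have "(x, y) \<in> E" using y x I by blast
  \<comment> \<open>The witness is \<open>{z}\<close>: if \<open>z\<close> is the only value at
    \<open>m\<close>, then \<open>{z}\<close> is the only value at a successor of \<open>m\<close>,
    and \<open>I\<close> contains one.\<close>
  moreover have "\<exists>w\<in>M. (z, w) \<in> E \<and> (w, y) \<in> E" if z: "z \<in> M" "(z, y) \<in> E" for z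
  proof -
    obtain m where m: "m \<in> M" "(m, I) \<in> E" "G m z" using y z by blast
    obtain n where n: "n \<in> M" "(n, I) \<in> E" "is_succ n m" using I m by blast
    obtain w where w: "w \<in> M" "is_sing w z" using sing_exists z by blast
    have "iter_sing x n w' \<longleftrightarrow> is_sing w' z" if "w' \<in> M" for w'
      using iter_sing_succ[OF n(1) m(1) n(3) that, of x] m(3) z(1) unfolding G_def by metis
    moreover have "is_sing w' z \<longleftrightarrow> w' = w" if "w' \<in> M" for w'
      using extensionality[of w' w] w that unfolding is_sing_def by blast
    ultimately have "G n w" unfolding G_def by blast
    then show ?thesis using y n w z unfolding is_sing_def by blast
  qed
  ultimately show ?thesis using y(1) by blast
qed

text \<open>
  The choice principle of \<open>set.mm\<close> follows from a transversal of the sets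
  \<open>{{u, w} | u \<in> w}\<close> for nonempty \<open>w \<in> x\<close>; these are disjoint because \<open>\<in>\<close> has no cycle of length two.
\<close>

lemma choice_unordered_pairs:
  assumes x: "x \<in> M"
  shows "\<exists>y\<in>M. \<forall>z\<in>M. \<forall>w\<in>M. (z, w) \<in> E \<and> (w, x) \<in> E \<longrightarrow>
    (\<exists>v\<in>M. \<forall>u\<in>M. (\<exists>t\<in>M. ((u, w) \<in> E \<and> (w, t) \<in> E) \<and> (u, t) \<in> E \<and> (t, y) \<in> E) \<longleftrightarrow> u = v)"
proof -
  define K where "K w k \<longleftrightarrow> (\<forall>t\<in>M. (t, k) \<in> E \<longleftrightarrow> (\<exists>u\<in>M. (u, w) \<in> E \<and> is_upair t u w))" for w k
  define ne where "ne w \<longleftrightarrow> (\<exists>u\<in>M. (u, w) \<in> E)" for w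
  have upair_unique: "t = t'" if "is_upair t u w" "is_upair t' u w" "t \<in> M" "t' \<in> M" for t t' u w
    using extensionality[of t t'] that unfolding is_upair_def by blast
  have K_unique: "k = k'" if "K w k" "K w k'" "k \<in> M" "k' \<in> M" for k k' w
    using extensionality[of k k'] that unfolding K_def by blast
  have K_exists: "\<exists>k\<in>M. K w k" if w: "w \<in> M" for w
  proof -
    have sat_u: "sat M E ((\<lambda>_. w)(0 := u, 1 := t)) (fm_upair 1 0 2) \<longleftrightarrow> is_upair t u w" for u t
      by (simp only: sat_eval sat_fm)
    have "\<exists>v\<in>M. \<forall>t\<in>M. is_upair t u w \<longrightarrow> t = v" if "u \<in> M" for u
      using upair_exists[OF that w] upair_unique by metis
    then obtain k where "k \<in> M"
      "\<And>t. t \<in> M \<Longrightarrow> (t, k) \<in> E \<longleftrightarrow> (\<exists>u\<in>M. (u, w) \<in> E \<and> is_upair t u w)"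
      using replacement[of "\<lambda>_. w" w 0 1 "fm_upair 1 0 2", unfolded sat_u, OF const_Ass[OF w] w zero_neq_one]
      by blast
    then show ?thesis unfolding K_def by blast
  qed
  \<comment> \<open>Variables 0 and 1 hold \<open>w\<close> and \<open>k\<close>. Only nonempty
    \<open>w\<close> contribute, since choice demands nonempty members.\<close>
  define pK where "pK = ((\<exists>\<^sub>f 3. 3 \<in>\<^sub>f 0) \<and>\<^sub>f
     (\<forall>\<^sub>f 4. 4 \<in>\<^sub>f 1 \<leftrightarrow>\<^sub>f (\<exists>\<^sub>f 3. 3 \<in>\<^sub>f 0 \<and>\<^sub>f fm_upair 4 3 0)))"
  have sat_K: "sat M E ((\<lambda>_. x)(0 := w, 1 := k)) pK \<longleftrightarrow> ne w \<and> K w k" for w k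
    by (simp only: K_def ne_def pK_def sat_eval sat_fm)
  obtain fam where fam: "fam \<in> M"
    "\<And>k. k \<in> M \<Longrightarrow> (k, fam) \<in> E \<longleftrightarrow> (\<exists>w\<in>M. (w, x) \<in> E \<and> ne w \<and> K w k)"
  proof (rule replacement[of "\<lambda>_. x" x 0 1 pK])
    show "\<exists>u\<in>M. \<forall>n\<in>M. sat M E ((\<lambda>_. x)(0 := m, 1 := n)) pK \<longrightarrow> n = u" if "m \<in> M" for m
      unfolding sat_K using K_exists[OF that] K_unique by metis
  qed (use x in \<open>simp_all only: sat_K const_Ass zero_neq_one simp_thms\<close>)
  \<comment> \<open>If \<open>w\<close> and \<open>w'\<close> differed, then \<open>u = w'\<close>
    and \<open>u' = w\<close>, which is a cycle of length two.\<close>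
  have upair_eq: "w = w'" if "is_upair t u w" "is_upair t u' w'" "(u, w) \<in> E" "(u', w') \<in> E"
    "u \<in> M" "w \<in> M" "u' \<in> M" "w' \<in> M" for t u w u' w'
    using that no_two_cycle[of w w'] unfolding is_upair_def by metis
  obtain c where c: "c \<in> M"
    "\<And>k. k \<in> M \<Longrightarrow> (k, fam) \<in> E \<Longrightarrow> \<exists>t\<in>M. \<forall>d\<in>M. (d, k) \<in> E \<and> (d, c) \<in> E \<longleftrightarrow> d = t"
  proof (rule choice[OF fam(1)])
    fix k assume k: "k \<in> M" "(k, fam) \<in> E"
    then obtain w u where w: "w \<in> M" "K w k" "u \<in> M" "(u, w) \<in> E"
      using fam unfolding ne_def by blast
    moreover obtain t where "t \<in> M" "is_upair t u w" using upair_exists w by blast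
    ultimately show "\<exists>t\<in>M. (t, k) \<in> E" unfolding K_def by blast
  next
    fix k k' t
    assume k: "k \<in> M" "k' \<in> M" "t \<in> M" "(k, fam) \<in> E" "(k', fam) \<in> E" "(t, k) \<in> E" "(t, k') \<in> E"
    then obtain w w' where w: "w \<in> M" "w' \<in> M" "K w k" "K w' k'" using fam by blast
    moreover from this k obtain u u' where "u \<in> M" "u' \<in> M" "(u, w) \<in> E" "(u', w') \<in> E"
      "is_upair t u w" "is_upair t u' w'" unfolding K_def by blast
    ultimately have "w = w'" using upair_eq by blast
    then show "k = k'" using K_unique w k by blast
  qed blast
  \<comment> \<open>Outside the members of the family \<open>c\<close> may contain anything. Keeping
    only pairs \<open>{u, w}\<close> with \<open>u\<close> in \<open>w\<close> prevents stray sets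
    that contain \<open>u\<close> and \<open>w\<close> from spoiling uniqueness.\<close>
  define pY where "pY = (\<exists>\<^sub>f 3. \<exists>\<^sub>f 4. 3 \<in>\<^sub>f 4 \<and>\<^sub>f fm_upair 0 3 4)"
  have sat_Y: "sat M E ((\<lambda>_. x)(0 := t)) pY \<longleftrightarrow> (\<exists>u\<in>M. \<exists>w\<in>M. (u, w) \<in> E \<and> is_upair t u w)" for t
    by (simp only: pY_def sat_eval sat_fm)
  obtain y where y: "y \<in> M"
    "\<And>t. t \<in> M \<Longrightarrow> (t, y) \<in> E \<longleftrightarrow> (t, c) \<in> E \<and> (\<exists>u\<in>M. \<exists>w\<in>M. (u, w) \<in> E \<and> is_upair t u w)"
    using separation[of "\<lambda>_. x" c 0 pY, unfolded sat_Y, OF const_Ass[OF x] c(1)] by blast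
  have "\<exists>v\<in>M. \<forall>u\<in>M. (\<exists>t\<in>M. ((u, w) \<in> E \<and> (w, t) \<in> E) \<and> (u, t) \<in> E \<and> (t, y) \<in> E) \<longleftrightarrow> u = v"
    if zw: "z \<in> M" "w \<in> M" "(z, w) \<in> E" "(w, x) \<in> E" for z w
  proof -
    obtain k where k: "k \<in> M" "K w k" using K_exists zw by blast
    then have "(k, fam) \<in> E" using fam zw unfolding ne_def by blast
    then obtain t where t: "t \<in> M" "\<And>d. d \<in> M \<Longrightarrow> (d, k) \<in> E \<and> (d, c) \<in> E \<longleftrightarrow> d = t"
      using c k by blast
    then obtain v where v: "v \<in> M" "(v, w) \<in> E" "is_upair t v w" "(t, c) \<in> E"
      using k unfolding K_def by blast
    have "(\<exists>t\<in>M. ((u, w) \<in> E \<and> (w, t) \<in> E) \<and> (u, t) \<in> E \<and> (t, y) \<in> E) \<longleftrightarrow> u = v"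
      if u: "u \<in> M" for u
    proof
      assume "u = v"
      then show "\<exists>t\<in>M. ((u, w) \<in> E \<and> (w, t) \<in> E) \<and> (u, t) \<in> E \<and> (t, y) \<in> E"
        using v t(1) y zw unfolding is_upair_def by blast
    next
      assume "\<exists>t\<in>M. ((u, w) \<in> E \<and> (w, t) \<in> E) \<and> (u, t) \<in> E \<and> (t, y) \<in> E"
      then obtain t' where t': "t' \<in> M" "(u, w) \<in> E" "(w, t') \<in> E" "(u, t') \<in> E" "(t', y) \<in> E"
        by blast
      then obtain a b where ab: "a \<in> M" "b \<in> M" "is_upair t' a b" "(t', c) \<in> E"
        using y by blast
      \<comment> \<open>\<open>t'\<close> is an unordered pair with the two different members
        \<open>u\<close> and \<open>w\<close>, so it is \<open>{u, w}\<close>.\<close>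
      have uw: "u \<noteq> w" using no_two_cycle zw t' by blast
      then have "is_upair t' u w"
        using ab(3) t' u zw(2) unfolding is_upair_def by metis
      then have "(t', k) \<in> E" using k t' u unfolding K_def by blast
      then have "t' = t" using t t'(1) ab(4) by blast
      then show "u = v" using v(3) t'(4) uw u unfolding is_upair_def by blast
    qed
    then show ?thesis using v(1) by blast
  qed
  then show ?thesis using y(1) by blast
qed

section \<open>The model of set.mm\<close>

definition definable :: "(nat \<Rightarrow> 'm) set \<Rightarrow> bool" where
  "definable P \<longleftrightarrow> (\<exists>p. P = {s \<in> Ass. sat M E s p})"

text \<open>Dependence is measured semantically, by changing one value of an assignment, so it does
  not hinge on the choice of a defining formula.\<close>

fun supp :: "'m universe \<Rightarrow> nat set" where
  "supp (Inl n) = {n}"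
| "supp (Inr (Inl P)) = {x. \<exists>s\<in>Ass. \<exists>m\<in>M. (s(x := m) \<in> P) \<noteq> (s \<in> P)}"
| "supp (Inr (Inr C)) = {x. \<exists>s\<in>Ass. \<exists>m\<in>M. \<exists>k\<in>M. ((s(x := m), k) \<in> C) \<noteq> ((s, k) \<in> C)}"

text \<open>A formula has no place for the element of a class, so a name \<open>z\<close> carries
  it. For \<open>z\<close> outside the support, the formula for \<open>(s, s z) \<in> C\<close>
  describes all of \<open>C\<close>; a finite support guarantees such a \<open>z\<close>.\<close>

definition classes :: "((nat \<Rightarrow> 'm) \<times> 'm) set set" where
  "classes = {C. C \<subseteq> Ass \<times> M \<and> finite (supp (Inr (Inr C)))
     \<and> (\<forall>z. definable {s \<in> Ass. (s, s z) \<in> C})}"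

fun univ :: "typecode \<Rightarrow> 'm universe set" where
  "univ TSet = range Inl"
| "univ TClass = (\<lambda>C. Inr (Inr C)) ` classes"
| "univ TWff = (\<lambda>P. Inr (Inl P)) ` {P. definable P}"
| "univ TProv = {Inr (Inl Ass)}"

definition var :: "'m universe \<Rightarrow> nat" where "var u = projl u"
definition wff :: "'m universe \<Rightarrow> (nat \<Rightarrow> 'm) set" where "wff u = projl (projr u)"
definition cls :: "'m universe \<Rightarrow> ((nat \<Rightarrow> 'm) \<times> 'm) set" where "cls u = projr (projr u)"

lemma proj_simps [simp]: "var (Inl n) = n" "wff (Inr (Inl P)) = P" "cls (Inr (Inr C)) = C"
  by (simp_all add: var_def wff_def cls_def)

text \<open>Classes are compared by extension. \<open>SMem\<close> asks for an element
  \<open>n\<close> of \<open>M\<close> with the same extension as the first class, so a class that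
  is no set belongs to nothing, as df-clel demands.\<close>

fun interp :: "synax \<Rightarrow> 'm universe list \<Rightarrow> 'm universe" where
  "interp SNot f = Inr (Inl {s \<in> Ass. s \<notin> wff (f ! 0)})"
| "interp SImp f = Inr (Inl {s \<in> Ass. s \<in> wff (f ! 0) \<longrightarrow> s \<in> wff (f ! 1)})"
| "interp SAll f = Inr (Inl {s \<in> Ass. \<forall>m\<in>M. s(var (f ! 0) := m) \<in> wff (f ! 1)})"
| "interp SAbs f = Inr (Inr {(s, m). s \<in> Ass \<and> m \<in> M \<and> s(var (f ! 0) := m) \<in> wff (f ! 1)})"
| "interp SCv f = Inr (Inr {(s, m). s \<in> Ass \<and> m \<in> M \<and> (m, s (var (f ! 0))) \<in> E})"
| "interp SEq f = Inr (Inl {s \<in> Ass. \<forall>m\<in>M. (s, m) \<in> cls (f ! 0) \<longleftrightarrow> (s, m) \<in> cls (f ! 1)})"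
| "interp SMem f = Inr (Inl {s \<in> Ass. \<exists>n\<in>M.
     (\<forall>m\<in>M. (s, m) \<in> cls (f ! 0) \<longleftrightarrow> (m, n) \<in> E) \<and> (s, n) \<in> cls (f ! 1)})"

lemma definableI:
  "P \<subseteq> Ass \<Longrightarrow> (\<And>s. s \<in> Ass \<Longrightarrow> s \<in> P \<longleftrightarrow> sat M E s p) \<Longrightarrow> definable P"
  unfolding definable_def by blast

lemma definableE:
  assumes "definable P"
  obtains p where "\<And>s. s \<in> Ass \<Longrightarrow> s \<in> P \<longleftrightarrow> sat M E s p"
  using assms unfolding definable_def by blast

text \<open>The support lies within the free variables of any defining formula.\<close>

lemma finite_supp_definable:
  assumes "definable P" shows "finite (supp (Inr (Inl P)))"
proof -
  obtain p where p: "\<And>s. s \<in> Ass \<Longrightarrow> s \<in> P \<longleftrightarrow> sat M E s p"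
    using definableE[OF assms] by blast
  have "x \<in> free_vars p" if "x \<in> supp (Inr (Inl P))" for x
  proof (rule ccontr)
    assume "x \<notin> free_vars p"
    then have "sat M E (s(x := m)) p \<longleftrightarrow> sat M E s p" for s m
      by (intro sat_cong) auto
    then show False using that p by auto
  qed
  then show ?thesis by (intro finite_subset[OF _ finite_free_vars[of p]] subsetI)
qed

lemma supp_wff: "x \<notin> supp (Inr (Inl P)) \<Longrightarrow> s \<in> Ass \<Longrightarrow> m \<in> M \<Longrightarrow> s(x := m) \<in> P \<longleftrightarrow> s \<in> P"
  by auto

lemma supp_cls:
  "x \<notin> supp (Inr (Inr C)) \<Longrightarrow> s \<in> Ass \<Longrightarrow> m \<in> M \<Longrightarrow> k \<in> M \<Longrightarrow> (s(x := m), k) \<in> C \<longleftrightarrow> (s, k) \<in> C"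
  by auto

lemma supp_wff_subset:
  "(\<And>x s m. x \<notin> X \<Longrightarrow> s \<in> Ass \<Longrightarrow> m \<in> M \<Longrightarrow> s(x := m) \<in> P \<longleftrightarrow> s \<in> P) \<Longrightarrow> supp (Inr (Inl P)) \<subseteq> X"
  unfolding supp.simps by blast

lemma supp_cls_subset:
  "(\<And>x s m k. x \<notin> X \<Longrightarrow> s \<in> Ass \<Longrightarrow> m \<in> M \<Longrightarrow> k \<in> M \<Longrightarrow>
     (s(x := m), k) \<in> C \<longleftrightarrow> (s, k) \<in> C) \<Longrightarrow> supp (Inr (Inr C)) \<subseteq> X"
  unfolding supp.simps by blast

lemmas [simp del] = supp.simps(2,3)

section \<open>Closure of the universe under the operations\<close>

lemma interp_Not:
  assumes "definable P"
  shows "definable {s \<in> Ass. s \<notin> P}" "supp (Inr (Inl {s \<in> Ass. s \<notin> P})) \<subseteq> supp (Inr (Inl P))"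
proof -
  obtain p where p: "\<And>s. s \<in> Ass \<Longrightarrow> s \<in> P \<longleftrightarrow> sat M E s p"
    using definableE[OF assms] by blast
  show "definable {s \<in> Ass. s \<notin> P}"
    by (rule definableI[where p = "\<not>\<^sub>f p"]) (auto simp: p)
  show "supp (Inr (Inl {s \<in> Ass. s \<notin> P})) \<subseteq> supp (Inr (Inl P))"
    by (rule supp_wff_subset) (auto simp: supp_wff)
qed

lemma interp_Imp:
  assumes "definable P" "definable Q"
  shows "definable {s \<in> Ass. s \<in> P \<longrightarrow> s \<in> Q}"
    "supp (Inr (Inl {s \<in> Ass. s \<in> P \<longrightarrow> s \<in> Q})) \<subseteq> supp (Inr (Inl P)) \<union> supp (Inr (Inl Q))"
proof -
  obtain p q where p: "\<And>s. s \<in> Ass \<Longrightarrow> s \<in> P \<longleftrightarrow> sat M E s p"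
    and q: "\<And>s. s \<in> Ass \<Longrightarrow> s \<in> Q \<longleftrightarrow> sat M E s q"
    using assms by (metis definableE)
  show "definable {s \<in> Ass. s \<in> P \<longrightarrow> s \<in> Q}"
    by (rule definableI[where p = "p \<rightarrow>\<^sub>f q"]) (auto simp: p q)
  show "supp (Inr (Inl {s \<in> Ass. s \<in> P \<longrightarrow> s \<in> Q})) \<subseteq> supp (Inr (Inl P)) \<union> supp (Inr (Inl Q))"
    by (rule supp_wff_subset) (auto simp: supp_wff)
qed

lemma interp_All:
  assumes "definable P"
  shows "definable {s \<in> Ass. \<forall>m\<in>M. s(x := m) \<in> P}"
    "supp (Inr (Inl {s \<in> Ass. \<forall>m\<in>M. s(x := m) \<in> P})) \<subseteq> supp (Inr (Inl P))"
proof -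
  obtain p where p: "\<And>s. s \<in> Ass \<Longrightarrow> s \<in> P \<longleftrightarrow> sat M E s p"
    using definableE[OF assms] by blast
  show "definable {s \<in> Ass. \<forall>m\<in>M. s(x := m) \<in> P}"
    by (rule definableI[where p = "\<forall>\<^sub>f x. p"]) (auto simp: p)
  \<comment> \<open>The updates commute if \<open>y\<close> and \<open>x\<close> differ; otherwise
    the first is overwritten.\<close>
  have "s(y := k, x := m) \<in> P \<longleftrightarrow> s(x := m) \<in> P"
    if "y \<notin> supp (Inr (Inl P))" "s \<in> Ass" "k \<in> M" "m \<in> M" for y s k m
    using supp_wff[OF that(1), of "s(x := m)" k] that by (cases "y = x") (auto simp: fun_upd_twist)
  then show "supp (Inr (Inl {s \<in> Ass. \<forall>m\<in>M. s(x := m) \<in> P})) \<subseteq> supp (Inr (Inl P))"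
    by (intro supp_wff_subset) auto
qed

lemma interp_Abs:
  assumes "definable P"
  defines "C \<equiv> \<lambda>x. {(s, m). s \<in> Ass \<and> m \<in> M \<and> s(x := m) \<in> P}"
  shows "C x \<in> classes" "supp (Inr (Inr (C x))) \<subseteq> supp (Inr (Inl P))"
proof -
  obtain p where p: "\<And>s. s \<in> Ass \<Longrightarrow> s \<in> P \<longleftrightarrow> sat M E s p"
    using definableE[OF assms(1)] by blast
  have "s(y := k, x := m) \<in> P \<longleftrightarrow> s(x := m) \<in> P"
    if "y \<notin> supp (Inr (Inl P))" "s \<in> Ass" "k \<in> M" "m \<in> M" for y s k m
    using supp_wff[OF that(1), of "s(x := m)" k] that by (cases "y = x") (auto simp: fun_upd_twist)
  then show supp: "supp (Inr (Inr (C x))) \<subseteq> supp (Inr (Inl P))"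
    by (intro supp_cls_subset) (auto simp: C_def)
  \<comment> \<open>Membership means \<open>s(x := s z) \<in> P\<close>, the substitution of
    \<open>z\<close> for \<open>x\<close>. If the names differ, it is expressed as "some
    \<open>x\<close> equals \<open>z\<close> and satisfies \<open>p\<close>", which avoids syntactic
    substitution; if they coincide, the update changes nothing.\<close>
  have "definable {s \<in> Ass. (s, s z) \<in> C x}" for z
  proof (cases "z = x")
    case True
    then show ?thesis
      by (intro definableI[where p = p]) (auto simp: C_def p Ass_in)
  next
    case False
    then show ?thesis
      by (intro definableI[where p = "\<not>\<^sub>f (\<forall>\<^sub>f x. x =\<^sub>f z \<rightarrow>\<^sub>f \<not>\<^sub>f p)"]) (auto simp: C_def p)
  qed
  then show "C x \<in> classes"
    using finite_subset[OF supp finite_supp_definable[OF assms(1)]] unfolding classes_def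
    by (auto simp: C_def)
qed

lemma interp_Cv:
  defines "C \<equiv> \<lambda>x. {(s, m). s \<in> Ass \<and> m \<in> M \<and> (m, s x) \<in> E}"
  shows "C x \<in> classes" "supp (Inr (Inr (C x))) \<subseteq> {x}"
proof -
  show supp: "supp (Inr (Inr (C x))) \<subseteq> {x}"
    by (intro supp_cls_subset) (auto simp: C_def)
  have "definable {s \<in> Ass. (s, s z) \<in> C x}" for z
    by (rule definableI[where p = "z \<in>\<^sub>f x"]) (auto simp: C_def Ass_in)
  then show "C x \<in> classes"
    using finite_subset[OF supp] unfolding classes_def by (auto simp: C_def)
qed

lemma classes_at:
  assumes "C \<in> classes"
  obtains p where "\<And>s. s \<in> Ass \<Longrightarrow> sat M E s p \<longleftrightarrow> (s, s z) \<in> C"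
proof -
  have "definable {s \<in> Ass. (s, s z) \<in> C}" using assms by (simp add: classes_def)
  then show ?thesis using that by (elim definableE) auto
qed

lemma fresh_var: "finite X \<Longrightarrow> \<exists>z::nat. z \<notin> X"
  by (rule ex_new_if_finite[OF infinite_UNIV_nat])

text \<open>A name outside both supports carries the element \<open>m\<close>, so the quantifier
  over \<open>M\<close> becomes a first-order one.\<close>

lemma interp_Eq:
  assumes "A \<in> classes" "B \<in> classes"
  defines "P \<equiv> {s \<in> Ass. \<forall>m\<in>M. (s, m) \<in> A \<longleftrightarrow> (s, m) \<in> B}"
  shows "definable P" "supp (Inr (Inl P)) \<subseteq> supp (Inr (Inr A)) \<union> supp (Inr (Inr B))"
proof -
  show "supp (Inr (Inl P)) \<subseteq> supp (Inr (Inr A)) \<union> supp (Inr (Inr B))"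
    by (intro supp_wff_subset) (auto simp: P_def supp_cls)
  obtain z where z: "z \<notin> supp (Inr (Inr A))" "z \<notin> supp (Inr (Inr B))"
    using fresh_var[of "supp (Inr (Inr A)) \<union> supp (Inr (Inr B))"] assms
    by (auto simp: classes_def)
  obtain a where a: "\<And>s. s \<in> Ass \<Longrightarrow> sat M E s a \<longleftrightarrow> (s, s z) \<in> A"
    using classes_at[OF assms(1)] by blast
  obtain b where b: "\<And>s. s \<in> Ass \<Longrightarrow> sat M E s b \<longleftrightarrow> (s, s z) \<in> B"
    using classes_at[OF assms(2)] by blast
  have a': "sat M E (s(z := m)) a \<longleftrightarrow> (s, m) \<in> A" if "s \<in> Ass" "m \<in> M" for s m
    using that a[of "s(z := m)"] z by (simp add: supp_cls)
  have b': "sat M E (s(z := m)) b \<longleftrightarrow> (s, m) \<in> B" if "s \<in> Ass" "m \<in> M" for s m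
    using that b[of "s(z := m)"] z by (simp add: supp_cls)
  show "definable P"
  proof (rule definableI[where p = "\<forall>\<^sub>f z. a \<leftrightarrow>\<^sub>f b"])
    show "s \<in> P \<longleftrightarrow> sat M E s (\<forall>\<^sub>f z. a \<leftrightarrow>\<^sub>f b)" if "s \<in> Ass" for s
    proof -
      have "sat M E s (\<forall>\<^sub>f z. a \<leftrightarrow>\<^sub>f b) \<longleftrightarrow> (\<forall>m\<in>M. sat M E (s(z := m)) a \<longleftrightarrow> sat M E (s(z := m)) b)"
        by (simp only: sat_eval)
      also have "\<dots> \<longleftrightarrow> s \<in> P"
        using a'[OF that] b'[OF that] that unfolding P_def by simp
      finally show ?thesis by simp
    qed
  qed (auto simp: P_def)
qed

lemma interp_Mem:
  assumes "A \<in> classes" "B \<in> classes"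
  defines "P \<equiv> {s \<in> Ass. \<exists>n\<in>M. (\<forall>m\<in>M. (s, m) \<in> A \<longleftrightarrow> (m, n) \<in> E) \<and> (s, n) \<in> B}"
  shows "definable P" "supp (Inr (Inl P)) \<subseteq> supp (Inr (Inr A)) \<union> supp (Inr (Inr B))"
proof -
  show "supp (Inr (Inl P)) \<subseteq> supp (Inr (Inr A)) \<union> supp (Inr (Inr B))"
    by (intro supp_wff_subset) (auto simp: P_def supp_cls)
  let ?X = "supp (Inr (Inr A)) \<union> supp (Inr (Inr B))"
  have fin: "finite ?X" using assms by (auto simp: classes_def)
  obtain z where z: "z \<notin> ?X" using fresh_var[OF fin] by blast
  \<comment> \<open>A second name, for \<open>n\<close>: it is in scope together with
    \<open>z\<close>, so it must differ from \<open>z\<close>.\<close>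
  obtain y where y: "y \<notin> insert z ?X" using fresh_var[of "insert z ?X"] fin by auto
  obtain a where a: "\<And>s. s \<in> Ass \<Longrightarrow> sat M E s a \<longleftrightarrow> (s, s z) \<in> A"
    using classes_at[OF assms(1)] by blast
  obtain b where b: "\<And>s. s \<in> Ass \<Longrightarrow> sat M E s b \<longleftrightarrow> (s, s y) \<in> B"
    using classes_at[OF assms(2)] by blast
  have a': "sat M E (s(y := n, z := m)) a \<longleftrightarrow> (s, m) \<in> A" if "s \<in> Ass" "n \<in> M" "m \<in> M" for s n m
    using that a[of "s(y := n, z := m)"] z y by (auto simp: supp_cls)
  have b': "sat M E (s(y := n)) b \<longleftrightarrow> (s, n) \<in> B" if "s \<in> Ass" "n \<in> M" for s n
    using that b[of "s(y := n)"] y by (auto simp: supp_cls)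
  show "definable P"
  proof (rule definableI[where p = "\<exists>\<^sub>f y. (\<forall>\<^sub>f z. a \<leftrightarrow>\<^sub>f z \<in>\<^sub>f y) \<and>\<^sub>f b"])
    show "s \<in> P \<longleftrightarrow> sat M E s (\<exists>\<^sub>f y. (\<forall>\<^sub>f z. a \<leftrightarrow>\<^sub>f z \<in>\<^sub>f y) \<and>\<^sub>f b)" if "s \<in> Ass" for s
    proof -
      have "(z = y) = False" "(y = z) = False" using y by auto
      then have "sat M E s (\<exists>\<^sub>f y. (\<forall>\<^sub>f z. a \<leftrightarrow>\<^sub>f z \<in>\<^sub>f y) \<and>\<^sub>f b) \<longleftrightarrow>
          (\<exists>n\<in>M. (\<forall>m\<in>M. sat M E (s(y := n, z := m)) a \<longleftrightarrow> (m, n) \<in> E) \<and> sat M E (s(y := n)) b)"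
        by (simp only: sat_eval)
      also have "\<dots> \<longleftrightarrow> s \<in> P"
        using a'[OF that] b'[OF that] that unfolding P_def by simp
      finally show ?thesis by simp
    qed
  qed (auto simp: P_def)
qed

lemma interp_closed:
  assumes "f \<in> arg_tuples set_mm univ a"
  shows "interp a f \<in> univ (synax_type a) \<and> supp (interp a f) \<subseteq> (\<Union>u\<in>set f. supp u)"
proof (cases a)
  case SNot
  then obtain P where f: "f = [Inr (Inl P)]" and d: "definable P"
    using assms by (auto simp: arg_tuples_def set_mm_def list_all2_Cons2)
  show ?thesis unfolding f SNot using interp_Not[OF d] by simp
next
  case SImp
  then obtain P Q where f: "f = [Inr (Inl P), Inr (Inl Q)]" and d: "definable P" "definable Q"
    using assms by (auto simp: arg_tuples_def set_mm_def list_all2_Cons2)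
  show ?thesis unfolding f SImp using interp_Imp[OF d] by simp
next
  case SAll
  then obtain x P where f: "f = [Inl x, Inr (Inl P)]" and d: "definable P"
    using assms by (auto simp: arg_tuples_def set_mm_def list_all2_Cons2)
  show ?thesis unfolding f SAll using interp_All[OF d, of x] by (simp add: subset_insertI2)
next
  case SAbs
  then obtain x P where f: "f = [Inl x, Inr (Inl P)]" and d: "definable P"
    using assms by (auto simp: arg_tuples_def set_mm_def list_all2_Cons2)
  show ?thesis unfolding f SAbs using interp_Abs[OF d, of x] by (simp add: subset_insertI2)
next
  case SCv
  then obtain x where f: "f = [Inl x]"
    using assms by (auto simp: arg_tuples_def set_mm_def list_all2_Cons2)
  show ?thesis unfolding f SCv using interp_Cv[of x] by simp
next
  case SEq
  then obtain A B where f: "f = [Inr (Inr A), Inr (Inr B)]" and d: "A \<in> classes" "B \<in> classes"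
    using assms by (auto simp: arg_tuples_def set_mm_def list_all2_Cons2)
  show ?thesis unfolding f SEq using interp_Eq[OF d] by simp
next
  case SMem
  then obtain A B where f: "f = [Inr (Inr A), Inr (Inr B)]" and d: "A \<in> classes" "B \<in> classes"
    using assms by (auto simp: arg_tuples_def set_mm_def list_all2_Cons2)
  show ?thesis unfolding f SMem using interp_Mem[OF d] by simp
qed

lemma definable_Ass: "definable Ass"
  by (rule definableI[where p = "0 =\<^sub>f 0"]) simp_all

lemma univ_TProv_subset: "univ TProv \<subseteq> univ TWff"
  using definable_Ass unfolding univ.simps by blast

text \<open>Supplies a class with empty support, which is fresh for everything.\<close>

lemma empty_class: "{} \<in> classes"
proof -
  have "definable {}" by (rule definableI[where p = "\<not>\<^sub>f 0 =\<^sub>f 0"]) simp_all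
  then show ?thesis by (simp add: classes_def supp.simps)
qed

lemma finite_supp:
  assumes "u \<in> univ c" shows "finite (supp u)"
proof -
  have "finite (supp (Inr (Inr C)))" if "C \<in> classes" for C
    using that unfolding classes_def by blast
  then have "finite (supp u)" if "u \<in> univ TSet \<union> univ TClass \<union> univ TWff" for u
    using that finite_supp_definable by auto
  then show ?thesis using assms univ_TProv_subset by (cases c) blast+
qed

lemma supp_Ass: "supp (Inr (Inl Ass)) = {}"
  using supp_wff_subset[of "{}" Ass] Ass_upd by blast

end

section \<open>Soundness of the statements of set.mm\<close>

locale set_mm_valuation = zfc_model M E
  for M :: "'m set" and E :: "('m \<times> 'm) set" +
  fixes \<mu> :: "mvar \<Rightarrow> 'm universe"
  assumes valuation: "valuation set_mm univ \<mu>"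
begin

abbreviation V :: "nat \<Rightarrow> nat" where "V i \<equiv> var (\<mu> (SetV i))"

definition holds :: "(nat \<Rightarrow> 'm) \<Rightarrow> mtree \<Rightarrow> bool" where
  "holds s t \<longleftrightarrow> s \<in> wff (eval_tree interp \<mu> t)"

definition mem :: "(nat \<Rightarrow> 'm) \<Rightarrow> 'm \<Rightarrow> mtree \<Rightarrow> bool" where
  "mem s m t \<longleftrightarrow> (s, m) \<in> cls (eval_tree interp \<mu> t)"

lemma mu_SetV: "\<mu> (SetV i) = Inl (V i)"
proof -
  have "\<mu> (SetV i) \<in> univ (mvar_type (SetV i))"
    using valuation by (simp only: valuation_def set_mm_def tfs.simps UNIV_I ball_UNIV)
  then show ?thesis by auto
qed

lemma supp_SetV: "supp (\<mu> (SetV i)) = {V i}"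
  by (subst mu_SetV) (rule supp.simps(1))

lemma mu_WffV: "\<exists>P. \<mu> (WffV i) = Inr (Inl P) \<and> definable P"
proof -
  have "\<mu> (WffV i) \<in> univ (mvar_type (WffV i))"
    using valuation by (simp only: valuation_def set_mm_def tfs.simps UNIV_I ball_UNIV)
  then show ?thesis by auto
qed

lemma mu_ClassV: "\<exists>C. \<mu> (ClassV i) = Inr (Inr C) \<and> C \<in> classes"
proof -
  have "\<mu> (ClassV i) \<in> univ (mvar_type (ClassV i))"
    using valuation by (simp only: valuation_def set_mm_def tfs.simps UNIV_I ball_UNIV)
  then show ?thesis by auto
qed

lemma same_extension:
  "a \<in> M \<Longrightarrow> b \<in> M \<Longrightarrow> (\<forall>m\<in>M. (m, a) \<in> E \<longleftrightarrow> (m, b) \<in> E) \<longleftrightarrow> a = b"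
  using extensionality[of a b] by blast

lemma holds_Eq: "s \<in> Ass \<Longrightarrow> holds s (A \<^bold>= B) \<longleftrightarrow> (\<forall>m\<in>M. mem s m A \<longleftrightarrow> mem s m B)"
  by (simp add: holds_def mem_def)

lemma holds_Mem:
  "s \<in> Ass \<Longrightarrow> holds s (A \<^bold>\<in> B) \<longleftrightarrow> (\<exists>n\<in>M. (\<forall>m\<in>M. mem s m A \<longleftrightarrow> (m, n) \<in> E) \<and> mem s n B)"
  by (simp add: holds_def mem_def)

lemma mem_Cv: "s \<in> Ass \<Longrightarrow> m \<in> M \<Longrightarrow> mem s m \<langle>SetV i\<rangle> \<longleftrightarrow> (m, s (V i)) \<in> E"
  by (simp add: mem_def)

lemma mem_Abs:
  "s \<in> Ass \<Longrightarrow> m \<in> M \<Longrightarrow> mem s m \<^bold>{SetV i \<^bold>| p\<^bold>} \<longleftrightarrow> holds (s(V i := m)) p"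
  by (simp add: mem_def holds_def)

text \<open>Extensionality in \<open>M\<close> turns equality of extensions into identity.\<close>

lemma holds_Cv_Eq: "s \<in> Ass \<Longrightarrow> holds s (\<langle>SetV i\<rangle> \<^bold>= \<langle>SetV j\<rangle>) \<longleftrightarrow> s (V i) = s (V j)"
  using same_extension[of "s (V i)" "s (V j)"] by (simp add: holds_Eq mem_Cv Ass_in)

text \<open>By extensionality, the only \<open>n\<close> with the extension of the variable is its
  value.\<close>

lemma holds_Cv_Mem:
  assumes "s \<in> Ass" shows "holds s (\<langle>SetV i\<rangle> \<^bold>\<in> B) \<longleftrightarrow> mem s (s (V i)) B"
proof -
  have "(\<forall>m\<in>M. mem s m \<langle>SetV i\<rangle> \<longleftrightarrow> (m, n) \<in> E) \<longleftrightarrow> s (V i) = n" if "n \<in> M" for n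
    using same_extension[of "s (V i)" n] assms that by (simp add: mem_Cv Ass_in)
  then show ?thesis
    unfolding holds_Mem[OF assms] using Ass_in[OF assms] by blast
qed

lemma holds_simps:
  assumes "s \<in> Ass"
  shows "holds s (p \<^bold>\<rightarrow> q) \<longleftrightarrow> (holds s p \<longrightarrow> holds s q)"
    "holds s (\<^bold>\<forall>SetV i. p) \<longleftrightarrow> (\<forall>m\<in>M. holds (s(V i := m)) p)"
    "holds s (\<langle>SetV i\<rangle> \<^bold>= \<langle>SetV j\<rangle>) \<longleftrightarrow> s (V i) = s (V j)"
    "holds s (\<langle>SetV i\<rangle> \<^bold>= Var v) \<longleftrightarrow> (\<forall>m\<in>M. (m, s (V i)) \<in> E \<longleftrightarrow> mem s m (Var v))"
    "holds s (Var v \<^bold>= Var w) \<longleftrightarrow> (\<forall>m\<in>M. mem s m (Var v) \<longleftrightarrow> mem s m (Var w))"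
    "holds s (\<langle>SetV i\<rangle> \<^bold>\<in> \<langle>SetV j\<rangle>) \<longleftrightarrow> (s (V i), s (V j)) \<in> E"
    "holds s (\<langle>SetV i\<rangle> \<^bold>\<in> Var v) \<longleftrightarrow> mem s (s (V i)) (Var v)"
    "holds s (\<langle>SetV i\<rangle> \<^bold>\<in> \<^bold>{SetV j \<^bold>| p\<^bold>}) \<longleftrightarrow> holds (s(V j := s (V i))) p"
    "holds s (Var v \<^bold>\<in> Var w) \<longleftrightarrow>
      (\<exists>n\<in>M. (\<forall>m\<in>M. mem s m (Var v) \<longleftrightarrow> (m, n) \<in> E) \<and> mem s n (Var w))"
proof -
  show "holds s (p \<^bold>\<rightarrow> q) \<longleftrightarrow> (holds s p \<longrightarrow> holds s q)"
    "holds s (\<^bold>\<forall>SetV i. p) \<longleftrightarrow> (\<forall>m\<in>M. holds (s(V i := m)) p)"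
    using assms by (simp_all add: holds_def)
qed (use assms Ass_in[OF assms] in
    \<open>simp_all only: holds_Cv_Eq holds_Cv_Mem mem_Cv mem_Abs\<close>,
    use assms in \<open>simp_all add: holds_Eq holds_Mem mem_Cv\<close>)

lemma holds_neg: "s \<in> Ass \<Longrightarrow> holds s (\<^bold>\<not> p) \<longleftrightarrow> \<not> holds s p"
  by (simp add: holds_def)

text \<open>Negation is pushed inwards as in \<open>sat_FNot\<close>, so that the abbreviations for
  conjunction and existence turn into the connectives of HOL.\<close>

lemma holds_Not:
  assumes "s \<in> Ass"
  shows "holds s (\<^bold>\<not> \<^bold>\<not> p) \<longleftrightarrow> holds s p"
    "holds s (\<^bold>\<not> (p \<^bold>\<rightarrow> q)) \<longleftrightarrow> holds s p \<and> holds s (\<^bold>\<not> q)"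
    "holds s (\<^bold>\<not> (\<^bold>\<forall>SetV i. p)) \<longleftrightarrow> (\<exists>m\<in>M. holds (s(V i := m)) (\<^bold>\<not> p))"
    "holds s (\<^bold>\<not> A \<^bold>= B) \<longleftrightarrow> \<not> holds s (A \<^bold>= B)"
    "holds s (\<^bold>\<not> A \<^bold>\<in> B) \<longleftrightarrow> \<not> holds s (A \<^bold>\<in> B)"
    "holds s (\<^bold>\<not> Var v) \<longleftrightarrow> \<not> holds s (Var v)"
  using assms by (auto simp: holds_simps(1,2) holds_neg)

lemma holds_fresh:
  assumes "V i \<notin> supp (\<mu> (WffV j))" "s \<in> Ass" "m \<in> M"
  shows "holds (s(V i := m)) (Var (WffV j)) \<longleftrightarrow> holds s (Var (WffV j))"
proof -
  obtain P where P: "\<mu> (WffV j) = Inr (Inl P)" using mu_WffV[of j] by blast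
  show ?thesis
    using supp_wff[OF assms[unfolded P]] unfolding holds_def eval_tree.simps P proj_simps .
qed

lemma mem_fresh:
  assumes "V i \<notin> supp (\<mu> (ClassV j))" "s \<in> Ass" "m \<in> M" "k \<in> M"
  shows "mem (s(V i := m)) k (Var (ClassV j)) \<longleftrightarrow> mem s k (Var (ClassV j))"
proof -
  obtain C where C: "\<mu> (ClassV j) = Inr (Inr C)" using mu_ClassV[of j] by blast
  show ?thesis
    using supp_cls[OF assms[unfolded C]] unfolding mem_def eval_tree.simps C proj_simps .
qed

definition sound :: "(typecode, mvar, synax) stmt \<Rightarrow> bool" where
  "sound = (\<lambda>(D, H, A). (\<forall>\<alpha> \<beta>. {\<alpha>, \<beta>} \<in> D \<longrightarrow> supp (\<mu> \<alpha>) \<inter> supp (\<mu> \<beta>) = {})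
     \<longrightarrow> (\<forall>h\<in>H. eval_expr univ interp \<mu> h \<noteq> None) \<longrightarrow> eval_expr univ interp \<mu> A \<noteq> None)"

text \<open>Split by the head of the tree, because truth under all assignments yields the value
  \<open>Inr (Inl Ass)\<close> only if the value is known to be a set of assignments contained in
  \<open>Ass\<close>.\<close>

lemma provable_iff:
  "eval_expr univ interp \<mu> (\<^bold>\<turnstile> p \<^bold>\<rightarrow> q) \<noteq> None \<longleftrightarrow> (\<forall>s\<in>Ass. holds s (p \<^bold>\<rightarrow> q))"
  "eval_expr univ interp \<mu> (\<^bold>\<turnstile> \<^bold>\<not> p) \<noteq> None \<longleftrightarrow> (\<forall>s\<in>Ass. holds s (\<^bold>\<not> p))"
  "eval_expr univ interp \<mu> (\<^bold>\<turnstile> (\<^bold>\<forall>SetV i. p)) \<noteq> None \<longleftrightarrow> (\<forall>s\<in>Ass. holds s (\<^bold>\<forall>SetV i. p))"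
  "eval_expr univ interp \<mu> (\<^bold>\<turnstile> Var (WffV j)) \<noteq> None \<longleftrightarrow> (\<forall>s\<in>Ass. holds s (Var (WffV j)))"
proof -
  have full: "{s \<in> Ass. Q s} = Ass \<longleftrightarrow> (\<forall>s\<in>Ass. Q s)" for Q
    by blast
  have "eval_expr univ interp \<mu> (\<^bold>\<turnstile> p) \<noteq> None \<longleftrightarrow> eval_tree interp \<mu> p = Inr (Inl Ass)" for p
    by (simp add: eval_expr_def)
  moreover obtain P where P: "\<mu> (WffV j) = Inr (Inl P)" "P \<subseteq> Ass"
    using mu_WffV[of j] unfolding definable_def by blast
  ultimately show
    "eval_expr univ interp \<mu> (\<^bold>\<turnstile> p \<^bold>\<rightarrow> q) \<noteq> None \<longleftrightarrow> (\<forall>s\<in>Ass. holds s (p \<^bold>\<rightarrow> q))"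
    "eval_expr univ interp \<mu> (\<^bold>\<turnstile> \<^bold>\<not> p) \<noteq> None \<longleftrightarrow> (\<forall>s\<in>Ass. holds s (\<^bold>\<not> p))"
    "eval_expr univ interp \<mu> (\<^bold>\<turnstile> (\<^bold>\<forall>SetV i. p)) \<noteq> None \<longleftrightarrow> (\<forall>s\<in>Ass. holds s (\<^bold>\<forall>SetV i. p))"
    "eval_expr univ interp \<mu> (\<^bold>\<turnstile> Var (WffV j)) \<noteq> None \<longleftrightarrow> (\<forall>s\<in>Ass. holds s (Var (WffV j)))"
    by (simp_all add: holds_def full) blast
qed

lemmas translate = sound_def case_prod_conv provable_iff holds_simps holds_Not
  iff_conv_conj_imp[symmetric] fun_upd_apply if_True if_False simp_thms
  ball_simps empty_iff insert_iff Ass_upd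

section \<open>Verification of the three groups of statements\<close>

lemma logic_sound: "Ball logic_stmts sound"
proof -
  \<comment> \<open>For exchanging quantifiers, which may bind the same name.\<close>
  have twist: "s(a := m, b := n) \<in> P" if "\<forall>m\<in>M. \<forall>n\<in>M. s(b := m, a := n) \<in> P" "m \<in> M" "n \<in> M"
    for s :: "nat \<Rightarrow> 'm" and a b m n P
    using that by (cases "a = b") (auto simp: fun_upd_twist)
  \<comment> \<open>For the substitution axiom. If the names differ, then
    \<open>k = s b = s a\<close> and the update at \<open>a\<close> changes nothing; if they
    coincide, it is an instance of the premise.\<close>
  have subst: "s(a := k) \<in> P" if "\<forall>m\<in>M. s(b := m) \<in> P" "s a = s b" "k \<in> M" "s b \<in> M"
    "k = (if b = a then k else s b)" for s :: "nat \<Rightarrow> 'm" and a b k P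
  proof (cases "b = a")
    case False
    then have "s(a := k) = s" using that(2,5) by (simp add: fun_upd_idem)
    then show ?thesis using bspec[OF that(1,4)] by simp
  qed (use that(1,3) in blast)
  have fr: "holds (s(V 0 := m)) PH" if "\<forall>\<alpha> \<beta>. {\<alpha>, \<beta>} = {vx, vph} \<longrightarrow> supp (\<mu> \<alpha>) \<inter> supp (\<mu> \<beta>) = {}"
    "s \<in> Ass" "m \<in> M" "holds s PH" for s m
  proof -
    have "V 0 \<notin> supp (\<mu> vph)" using that(1)[rule_format, OF refl] by (simp add: supp_SetV)
    then show ?thesis using that holds_fresh by blast
  qed
  show ?thesis
    unfolding logic_stmts_def
    apply (simp only: translate cong: ball_cong bex_cong)
    apply (intro conjI)
                  apply blast
                 apply blast
                apply blast
               apply blast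
              apply blast
             \<comment> \<open>The inner quantifier overwrites the value that the outer one assigns
               to the same name.\<close>
             apply (simp only: fun_upd_upd, blast)
    subgoal unfolding holds_def using twist by blast
           apply (blast intro: Ass_upd)
          apply simp
    subgoal using Ass_in by auto
    subgoal unfolding holds_def using subst Ass_in by blast
    \<comment> \<open>The premises that \<open>x\<close>, \<open>y\<close> differ and
      \<open>y\<close>, \<open>z\<close> agree force the name of \<open>x\<close> to differ from
      those of \<open>y\<close> and \<open>z\<close>, so neither value changes with
      \<open>x\<close>.\<close>
    subgoal by auto
      apply simp
     apply simp
    subgoal using fr by blast
    done
qed

text \<open>The two conjuncts of the substitution serve the two cases: the implication decides when
  the names coincide, the existential when they differ.\<close>

lemma clab_sound:
  assumes "s \<in> Ass"
  shows "holds (s(a := s b)) p \<longleftrightarrow> (s a = s b \<longrightarrow> holds s p) \<and>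
    (\<exists>m\<in>M. m = (if b = a then m else s b) \<and> holds (s(a := m)) p)"
proof (cases "b = a")
  case True
  have "s(a := s a) = s" by simp
  then show ?thesis using True Ass_in[OF assms, of a] by (auto intro: bexI[of _ "s a"])
next
  case False
  have "s(a := s b) = s" if "s a = s b" using that by (simp add: fun_upd_idem)
  then show ?thesis using False Ass_in[OF assms, of b] by auto
qed

lemma class_sound: "Ball class_stmts sound"
proof -
  have fr: "mem (s(V 0 := m)) k (Var (ClassV j)) \<longleftrightarrow> mem s k (Var (ClassV j))"
    if "supp (\<mu> vx) \<inter> supp (\<mu> (ClassV j)) = {}" "s \<in> Ass" "m \<in> M" "k \<in> M" for s m k j
    using that by (intro mem_fresh) (simp_all add: supp_SetV)
  \<comment> \<open>The left side is membership of classes; the right side is the existential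
    formula after \<open>x\<close> has received \<open>n\<close>, which classes without
    \<open>x\<close> in their support do not notice.\<close>
  have clel: "(\<forall>m\<in>M. mem s m CA \<longleftrightarrow> (m, n) \<in> E) \<and> mem s n CB \<longleftrightarrow>
      (\<forall>m\<in>M. (m, n) \<in> E \<longleftrightarrow> mem (s(V 0 := n)) m CA) \<and> mem (s(V 0 := n)) n CB"
    if "supp (\<mu> vx) \<inter> supp (\<mu> vA) = {}" "supp (\<mu> vx) \<inter> supp (\<mu> vB) = {}" "s \<in> Ass" "n \<in> M"
    for s n
    using fr[OF that(1,3,4)] fr[OF that(2,3,4)] that(4) by (simp only: cong: ball_cong) blast
  show ?thesis
    unfolding class_stmts_def
    apply (simp only: translate cong: ball_cong bex_cong)
    apply (intro conjI impI ballI)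
    subgoal using clab_sound .
    subgoal premises prems for s
    proof -
      have "supp (\<mu> vx) \<inter> supp (\<mu> vA) = {}" "supp (\<mu> vx) \<inter> supp (\<mu> vB) = {}"
        using prems(1) by blast+
      then show ?thesis using fr prems(3) by (simp cong: ball_cong)
    qed
    subgoal premises prems for s
    proof -
      have "supp (\<mu> vx) \<inter> supp (\<mu> vA) = {}" "supp (\<mu> vx) \<inter> supp (\<mu> vB) = {}"
        using prems(1) by blast+
      from clel[OF this prems(2)] show ?thesis by (intro bex_cong refl)
    qed
    done
qed

text \<open>Disjoint singleton supports make \<open>V\<close> injective on the variables concerned,
  so the ZFC statements can be read with genuinely different names.\<close>

lemma sound_pairs:
  assumes "inj_on V {i. SetV i \<in> S} \<Longrightarrow> eval_expr univ interp \<mu> A \<noteq> None"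
  shows "sound (pairs S, {}, A)"
  unfolding sound_def case_prod_conv
proof (intro impI assms inj_onI)
  fix i j
  assume "\<forall>\<alpha> \<beta>. {\<alpha>, \<beta>} \<in> pairs S \<longrightarrow> supp (\<mu> \<alpha>) \<inter> supp (\<mu> \<beta>) = {}"
    and "i \<in> {i. SetV i \<in> S}" "j \<in> {i. SetV i \<in> S}" "V i = V j"
  then show "i = j"
    using supp_SetV by (force simp: doubleton_in_pairs)
qed

lemma Ball_insertI: "P a \<Longrightarrow> Ball A P \<Longrightarrow> Ball (insert a A) P"
  by simp

lemma Ball_emptyI: "Ball {} P"
  by simp

lemmas translate_distinct = translate mem_Collect_eq mvar.inject numeral_eq_iff
  num.distinct num.inject zero_neq_numeral numeral_neq_zero zero_neq_one one_neq_zero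
  one_eq_numeral_iff numeral_eq_one_iff

text \<open>The wff may depend on \<open>y\<close>, but the quantifier over \<open>y\<close> in
  front of it hides the value \<open>a\<close>; replacement is applied to the quantified
  formula.\<close>

lemma replacement_wff:
  assumes "inj_on V {0, 1, 2, 3}" "s \<in> Ass"
    and fn: "\<forall>m\<in>M. \<exists>a\<in>M. \<forall>b\<in>M.
      (\<forall>c\<in>M. holds (s(V 3 := m, V 1 := a, V 2 := b, V 1 := c)) (Var (WffV j))) \<longrightarrow> b = a"
  shows "\<exists>a\<in>M. \<forall>b\<in>M. (b, a) \<in> E \<longleftrightarrow> (\<exists>m\<in>M. (m, s (V 0)) \<in> E \<and>
      (\<forall>c\<in>M. holds (s(V 1 := a, V 2 := b, V 3 := m, V 1 := c)) (Var (WffV j))))"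
proof -
  have ne: "V 1 \<noteq> V 2" "V 1 \<noteq> V 3" "V 2 \<noteq> V 3"
    using assms(1) by (auto dest: inj_onD)
  obtain p where p: "\<And>s. s \<in> Ass \<Longrightarrow> holds s (Var (WffV j)) \<longleftrightarrow> sat M E s p"
    using mu_WffV[of j] by (auto simp: holds_def elim: definableE)
  let ?p = "\<forall>\<^sub>f V 1. p"
  \<comment> \<open>In both orders of updates the value \<open>a\<close> is overwritten by
    \<open>c\<close>.\<close>
  have upd: "s(V 3 := m, V 1 := a, V 2 := b, V 1 := c) = s(V 3 := m, V 2 := b, V 1 := c)"
    "s(V 1 := a, V 2 := b, V 3 := m, V 1 := c) = s(V 3 := m, V 2 := b, V 1 := c)" for m a b c
    using ne by (auto simp: fun_eq_iff)
  have sat: "sat M E (s(V 3 := m, V 2 := b)) ?p \<longleftrightarrow>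
      (\<forall>c\<in>M. holds (s(V 3 := m, V 2 := b, V 1 := c)) (Var (WffV j)))" if "m \<in> M" "b \<in> M" for m b
    using that assms(2) by (simp add: p)
  obtain a where a: "a \<in> M" "\<And>n. n \<in> M \<Longrightarrow> (n, a) \<in> E \<longleftrightarrow>
      (\<exists>m\<in>M. (m, s (V 0)) \<in> E \<and> sat M E (s(V 3 := m, V 2 := n)) ?p)"
  proof (rule replacement[OF assms(2) Ass_in[OF assms(2)]])
    show "V 3 \<noteq> V 2" using ne by simp
    show "\<exists>u\<in>M. \<forall>n\<in>M. sat M E (s(V 3 := m, V 2 := n)) ?p \<longrightarrow> n = u" if "m \<in> M" for m
      using bspec[OF fn that] sat[OF that] unfolding upd by blast
  qed blast
  have "(n, a) \<in> E \<longleftrightarrow> (\<exists>m\<in>M. (m, s (V 0)) \<in> E \<and>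
      (\<forall>c\<in>M. holds (s(V 1 := a, V 2 := n, V 3 := m, V 1 := c)) (Var (WffV j))))" if "n \<in> M" for n
    unfolding a(2)[OF that] upd using sat[OF _ that] by blast
  then show ?thesis using a(1) by blast
qed

lemma zfc_sound: "Ball zfc_stmts sound"
proof (unfold zfc_stmts_def, intro Ball_insertI Ball_emptyI sound_pairs, goal_cases)
  case 1
  have "\<forall>a\<in>M. \<forall>b\<in>M. (\<forall>c\<in>M. (c, a) \<in> E \<longleftrightarrow> (c, b) \<in> E) \<longrightarrow> a = b"
    using same_extension by blast
  then show ?case
    by (simp only: translate_distinct inj_on_eq_iff[OF 1] cong: ball_cong bex_cong)
      (use Ass_in in blast)
next
  case 2
  have "{i. SetV i \<in> {vx, vy, vz, vw}} = {0, 1, 2, 3}" by auto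
  then have "inj_on V {0, 1, 2, 3}" using 2 by simp
  then show ?case
    by (simp only: translate_distinct inj_on_eq_iff[OF 2] cong: ball_cong bex_cong)
      (use replacement_wff in blast)
next
  case 3
  have "\<exists>c\<in>M. \<forall>d\<in>M. (\<forall>b\<in>M. (b, d) \<in> E \<longrightarrow> (b, a) \<in> E) \<longrightarrow> (d, c) \<in> E" if "a \<in> M" for a
    by (rule power[OF that]) blast
  then show ?case
    by (simp only: translate_distinct inj_on_eq_iff[OF 3] cong: ball_cong bex_cong)
      (use Ass_in in blast)
next
  case 4
  have "\<exists>c\<in>M. \<forall>d\<in>M. (\<exists>b\<in>M. (d, b) \<in> E \<and> (b, a) \<in> E) \<longrightarrow> (d, c) \<in> E" if "a \<in> M" for a
    by (rule union[OF that]) blast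
  then show ?case
    by (simp only: translate_distinct inj_on_eq_iff[OF 4] cong: ball_cong bex_cong)
      (use Ass_in in blast)
next
  case 5
  have "\<exists>c\<in>M. (c, a) \<in> E \<and> (\<forall>d\<in>M. (d, c) \<in> E \<longrightarrow> (d, a) \<notin> E)"
    if "a \<in> M" "\<exists>b\<in>M. (b, a) \<in> E" for a
  proof -
    obtain b where "b \<in> M" "(b, a) \<in> E" using \<open>\<exists>b\<in>M. (b, a) \<in> E\<close> by blast
    then show ?thesis by (rule foundation[OF \<open>a \<in> M\<close>]) blast
  qed
  then show ?case
    by (simp only: translate_distinct inj_on_eq_iff[OF 5] cong: ball_cong bex_cong)
      (use Ass_in in blast)
next
  case 6
  then show ?case
    by (simp only: translate_distinct inj_on_eq_iff[OF 6] cong: ball_cong bex_cong)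
      (use cofinal_set_exists Ass_in in blast)
next
  case 7
  then show ?case
    by (simp only: translate_distinct inj_on_eq_iff[OF 7] cong: ball_cong bex_cong)
      (intro ballI choice_unordered_pairs Ass_in)
qed

lemma stmts_sound: "s \<in> stmts set_mm \<Longrightarrow> sound s"
  using logic_sound class_sound zfc_sound by (auto simp: set_mm_def)

end

section \<open>The model and its nontriviality\<close>

context zfc_model
begin

definition fresh :: "((typecode \<times> 'm universe) \<times> (typecode \<times> 'm universe)) set" where
  "fresh = {(v, w). v \<in> dunion set_mm univ \<and> w \<in> dunion set_mm univ
     \<and> supp (snd v) \<inter> supp (snd w) = {}}"

lemma univ_mm_syn: "univ c \<subseteq> univ (mm_syn c)"
  using univ_TProv_subset by (cases c) (simp_all only: mm_syn.simps order_refl)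

lemma freshness_fresh: "freshness set_mm univ fresh"
  unfolding freshness_def
proof (intro conjI ballI allI impI)
  show "fresh \<subseteq> dunion set_mm univ \<times> dunion set_mm univ" "sym fresh"
    by (auto simp: fresh_def sym_def)
next
  fix c W
  assume c: "c \<in> VT set_mm" and W: "finite W \<and> W \<subseteq> dunion set_mm univ"
  have "finite (supp (snd w))" if "w \<in> W" for w
    using W that finite_supp by (auto simp: dunion_def)
  then have "finite (\<Union>w\<in>W. supp (snd w))" using W by blast
  then obtain n where n: "n \<notin> (\<Union>w\<in>W. supp (snd w))" using fresh_var by blast
  \<comment> \<open>For set variables the name \<open>n\<close> itself; for classes and wffs the
    empty class and \<open>Ass\<close>, whose supports are empty.\<close>
  have "\<exists>v\<in>univ c. supp v \<subseteq> {n}"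
  proof -
    have "supp (Inr (Inr {})) = {}" by (simp add: supp.simps)
    then show ?thesis
      using c empty_class definable_Ass supp_Ass unfolding VT_set_mm by fastforce
  qed
  then obtain v where "v \<in> univ c" "supp v \<subseteq> {n}" by blast
  then show "\<exists>v\<in>univ c. \<forall>w\<in>W. ((c, v), w) \<in> fresh"
    using W n by (intro bexI[of _ v] ballI) (auto simp: fresh_def dunion_def set_mm_def)
next
  fix c w z
  assume "w \<in> univ c" "z \<in> dunion set_mm univ"
  then show "((c, w), z) \<in> fresh \<longleftrightarrow> ((Syn set_mm c, w), z) \<in> fresh"
    using univ_mm_syn[of c] by (auto simp: fresh_def dunion_def set_mm_def)
qed

lemma set_mm_model: "tfs_model set_mm univ fresh interp"
  unfolding tfs_model_def
proof (intro conjI ballI allI impI)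
  show "univ c \<subseteq> univ (Syn set_mm c)" for c
    using univ_mm_syn by (simp add: set_mm_def)
  show "freshness set_mm univ fresh" by (rule freshness_fresh)
  show "interp a f \<in> univ (type_ax set_mm a)" if "f \<in> arg_tuples set_mm univ a" for a f
    using interp_closed[OF that] by (simp add: set_mm_def)
next
  fix \<mu> :: "mvar \<Rightarrow> 'm universe" and s
  assume \<mu>: "valuation set_mm univ \<mu>" and s: "s \<in> stmts set_mm"
  interpret set_mm_valuation M E \<mu> by unfold_locales (rule \<mu>)
  obtain D H A where DHA: "s = (D, H, A)" by (cases s)
  show "case s of (D, H, A) \<Rightarrow>
      (\<forall>\<alpha> \<beta>. {\<alpha>, \<beta>} \<in> D \<longrightarrow>
        ((type_var set_mm \<alpha>, \<mu> \<alpha>), (type_var set_mm \<beta>, \<mu> \<beta>)) \<in> fresh) \<and>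
      (\<forall>h\<in>H. eval_expr univ interp \<mu> h \<noteq> None) \<longrightarrow> eval_expr univ interp \<mu> A \<noteq> None"
    using stmts_sound[OF s] unfolding sound_def DHA case_prod_conv fresh_def by auto
next
  fix v a f
  assume v: "v \<in> dunion set_mm univ" and f: "f \<in> arg_tuples set_mm univ a"
    and fr: "\<forall>i<length (args set_mm a). (v, (type_var set_mm (args set_mm a ! i), f ! i)) \<in> fresh"
  have "length f = length (args set_mm a)"
    using f by (auto simp: arg_tuples_def dest: list_all2_lengthD)
  then have "supp (snd v) \<inter> (\<Union>u\<in>set f. supp u) = {}"
    using fr by (fastforce simp: fresh_def in_set_conv_nth)
  then show "(v, (type_ax set_mm a, interp a f)) \<in> fresh"
    using interp_closed[OF f] v by (auto simp: fresh_def dunion_def set_mm_def)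
qed

text \<open>The wff that fails under every assignment is not the provable one, since assignments
  exist.\<close>

lemma set_mm_nontrivial: "\<not> trivial_universe set_mm univ"
proof
  assume "trivial_universe set_mm univ"
  then have "univ TProv = univ (Syn set_mm TProv)"
    unfolding trivial_universe_def by (simp only: set_mm_def tfs.simps UNIV_I ball_UNIV)
  moreover have "definable {}" by (rule definableI[where p = "\<not>\<^sub>f 0 =\<^sub>f 0"]) simp_all
  ultimately have "Inr (Inl {}) \<in> univ TProv" by (simp add: set_mm_def)
  then show False using Ass_nonempty by simp
qed

end

theorem mainTheorem1:
  fixes M :: "'m set" and E :: "('m \<times> 'm) set"
  assumes "fo_model M E ZFC"
  shows "\<exists>(U :: typecode \<Rightarrow> 'm universe set) F \<pi>.
           tfs_model set_mm U F \<pi> \<and> \<not> trivial_universe set_mm U"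
proof -
  interpret zfc_model M E by unfold_locales (rule assms)
  show ?thesis using set_mm_model set_mm_nontrivial by blast
qed

end
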